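(* Let $H$ and $K$ be subgroups of a finite group $G$ and let $S$ be a set of representatives for the $(H,K)$ double cosets of $G$ (so that $G$ is the disjoint union of the sets $KsH$, $s\in S$). For $s\in S$ let $H_s=sHs^{-1}\cap K$, a subgroup of $K$. Denote the inclusions by $i:H\to G$ and $j:H_s\to K$, and let $f_s:H\to sHs^{-1}$, $f_s(g)=sgs^{-1}$, be conjugation by $s$. Then $$\mathbb{B}\mathrm{res}^G_K\circ\mathbb{B}_i=\bigoplus_{s\in S}\mathbb{B}_j\circ\mathbb{B}\mathrm{res}^{sHs^{-1}}_{H_s}\circ\mathbb{B}_{f_s}$$ as homomorphisms $\mathbb{B}_H\to\mathbb{B}_K$, where $\bigoplus$ denotes the sum in the abelian group $\mathbb{B}_K$.
   Context: For a finite group $G$ and $\gamma\in G$, $\hat\gamma$ denotes the conjugacy class of $\gamma$ in $G$ and $\hat\gamma^{-1}$ that of $\gamma^{-1}$. Let $\Lambda_G$ be the commutative monoid of unordered tuples $[\hat\gamma_1,\ldots,\hat\gamma_q]_G$ ($q\ge 0$) of conjugacy classes of $G$ with $\gamma_1\cdots\gamma_q\in[G,G]$, where tuples differing only by entries equal to the class of $1$ are identified; the addition $\oplus$ is concatenation and the zero element is the empty tuple. Define $\mathbb{B}_G:=\Lambda_G/\langle[\hat\gamma,\hat\gamma^{-1}]_G : \gamma\in G\rangle$ (quotient of the monoid by the indicated submonoid), an abelian group. A group homomorphism $f:H\to G$ induces the homomorphism $\mathbb{B}_f:\mathbb{B}_H\to\mathbb{B}_G$, $[\hat\gamma_1,\ldots,\hat\gamma_q]_H\mapsto[\widehat{f(\gamma_1)},\ldots,\widehat{f(\gamma_q)}]_G$.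 Every element $[\hat\gamma_1,\ldots,\hat\gamma_q]_G\in\mathbb{B}_G$ is the singular orbit data of an effective orientation preserving smooth action of $G$ on a compact connected oriented surface: the singular orbits $Gx$ (those with $|Gx|<|G|$) have representatives $x_1,\ldots,x_q$, the stabilizer $G_{x_i}$ is cyclic of order $\nu_i$, and $\gamma_i$ is its generator acting on the tangent space at $x_i$ by rotation through $2\pi/\nu_i$. For a subgroup $K\le G$ the restriction map $\mathbb{B}\mathrm{res}^G_K:\mathbb{B}_G\to\mathbb{B}_K$ sends the singular orbit data of a $G$-action to the singular orbit data of the action restricted to $K$. Explicitly, each entry $\hat\gamma_i$ is replaced by the entries $\widehat{t\gamma_i^{m}t^{-1}}$ (conjugacy classes in $K$), one for each double coset $Kt\langle\gamma_i\rangle$ in $G$, where $m=\min\{m\ge 1 : t\gamma_i^m t^{-1}\in K\}$. *)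

theory Defs
  imports "HOL-Algebra.Algebra" "HOL-Library.Multiset" "HOL-Library.Disjoint_Sets"
begin

definition conj_by :: "('a, 'm) monoid_scheme \<Rightarrow> 'a \<Rightarrow> 'a \<Rightarrow> 'a" where
  "conj_by G s g = s \<otimes>\<^bsub>G\<^esub> g \<otimes>\<^bsub>G\<^esub> inv\<^bsub>G\<^esub> s"

definition conj_class :: "('a, 'm) monoid_scheme \<Rightarrow> 'a \<Rightarrow> 'a set" where
  "conj_class G x = (\<lambda>g. conj_by G g x) ` carrier G"

definition dcoset :: "('a, 'm) monoid_scheme \<Rightarrow> 'a set \<Rightarrow> 'a \<Rightarrow> 'a set \<Rightarrow> 'a set" where
  "dcoset G A t B = (A #>\<^bsub>G\<^esub> t) <#>\<^bsub>G\<^esub> B"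

definition submonoid_gen :: "('a, 'm) monoid_scheme \<Rightarrow> 'a set \<Rightarrow> 'a set" where
  "submonoid_gen M A = \<Inter>{N. submonoid N M \<and> A \<subseteq> N}"

definition mquot_rel :: "('a, 'm) monoid_scheme \<Rightarrow> 'a set \<Rightarrow> 'a rel" where
  "mquot_rel M N = {(a, b). a \<in> carrier M \<and> b \<in> carrier M \<and>
     (\<exists>n\<in>N. \<exists>n'\<in>N. a \<otimes>\<^bsub>M\<^esub> n = b \<otimes>\<^bsub>M\<^esub> n')}"

definition mquot :: "('a, 'm) monoid_scheme \<Rightarrow> 'a set \<Rightarrow> 'a set monoid" where
  "mquot M N =
    \<lparr>carrier = carrier M // mquot_rel M N,
     monoid.mult = (\<lambda>U V. \<Union>x\<in>U. \<Union>y\<in>V. mquot_rel M N `` {x \<otimes>\<^bsub>M\<^esub> y}),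
     monoid.one = mquot_rel M N `` {\<one>\<^bsub>M\<^esub>}\<rparr>"

text \<open>
  An unordered tuple of conjugacy classes, up to entries equal to the class of the identity, is
  represented by the multiset of its entries different from that class.
\<close>

definition reduce_classes :: "('a, 'm) monoid_scheme \<Rightarrow> 'a set multiset \<Rightarrow> 'a set multiset" where
  "reduce_classes G A = filter_mset (\<lambda>C. C \<noteq> conj_class G \<one>\<^bsub>G\<^esub>) A"

definition class_tuple :: "('a, 'm) monoid_scheme \<Rightarrow> 'a list \<Rightarrow> 'a set multiset" where
  "class_tuple G \<gamma>s = reduce_classes G (mset (map (conj_class G) \<gamma>s))"

text \<open>
  Membership of the product in \<open>[G,G]\<close> depends neither on the order of the factors nor on the
  choice of representatives of the classes.
\<close>

definition admissible :: "('a, 'm) monoid_scheme \<Rightarrow> 'a list set" where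
  "admissible G = {\<gamma>s. set \<gamma>s \<subseteq> carrier G \<and>
     foldr (\<otimes>\<^bsub>G\<^esub>) \<gamma>s \<one>\<^bsub>G\<^esub> \<in> derived G (carrier G)}"

definition Lam :: "('a, 'm) monoid_scheme \<Rightarrow> 'a set multiset monoid" where
  "Lam G = \<lparr>carrier = class_tuple G ` admissible G, monoid.mult = (+), monoid.one = {#}\<rparr>"

definition inv_pairs :: "('a, 'm) monoid_scheme \<Rightarrow> 'a set multiset set" where
  "inv_pairs G = (\<lambda>\<gamma>. class_tuple G [\<gamma>, inv\<^bsub>G\<^esub> \<gamma>]) ` carrier G"

definition BB :: "('a, 'm) monoid_scheme \<Rightarrow> 'a set multiset set monoid" where
  "BB G = mquot (Lam G) (submonoid_gen (Lam G) (inv_pairs G))"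

definition BB_proj :: "('a, 'm) monoid_scheme \<Rightarrow> 'a set multiset \<Rightarrow> 'a set multiset set" where
  "BB_proj G A = mquot_rel (Lam G) (submonoid_gen (Lam G) (inv_pairs G)) `` {A}"

text \<open>
  The maps below are given on representing tuples; the definite description is
  meaningful because the result does not depend on the tuple chosen.
\<close>

definition BB_map ::
  "('a, 'm) monoid_scheme \<Rightarrow> ('b, 'n) monoid_scheme \<Rightarrow> ('a \<Rightarrow> 'b) \<Rightarrow>
   'a set multiset set \<Rightarrow> 'b set multiset set" where
  "BB_map H G f \<xi> = (THE \<eta>. \<exists>\<gamma>s\<in>admissible H.
     \<xi> = BB_proj H (class_tuple H \<gamma>s) \<and> \<eta> = BB_proj G (class_tuple G (map f \<gamma>s)))"

text \<open>
  The restriction of singular orbit data of a \<open>G\<close>-action to \<open>K\<close>: the \<open>G\<close>-orbit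
  with stabilizer \<open>\<langle>\<gamma>\<rangle>\<close> splits into \<open>K\<close>-orbits indexed by the double cosets
  \<open>K t \<langle>\<gamma>\<rangle>\<close>, with stabilizers \<open>K \<inter> t \<langle>\<gamma>\<rangle> t\<^sup>-\<^sup>1\<close>.
  For \<open>t \<in> G\<close>, the entry contributed by the double coset \<open>K t \<langle>\<gamma>\<rangle>\<close>; it depends only on
  that double coset.
\<close>

definition res_entry :: "('a, 'm) monoid_scheme \<Rightarrow> 'a set \<Rightarrow> 'a \<Rightarrow> 'a \<Rightarrow> 'a set" where
  "res_entry G K \<gamma> t =
     conj_class (G\<lparr>carrier := K\<rparr>)
       (conj_by G t (\<gamma> [^]\<^bsub>G\<^esub> (LEAST m::nat. 1 \<le> m \<and> conj_by G t (\<gamma> [^]\<^bsub>G\<^esub> m) \<in> K)))"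

definition res_classes :: "('a, 'm) monoid_scheme \<Rightarrow> 'a set \<Rightarrow> 'a \<Rightarrow> 'a set multiset" where
  "res_classes G K \<gamma> =
     image_mset (\<lambda>D. res_entry G K \<gamma> (SOME t. t \<in> D))
       (mset_set ((\<lambda>t. dcoset G K t (generate G {\<gamma>})) ` carrier G))"

definition BB_res ::
  "('a, 'm) monoid_scheme \<Rightarrow> 'a set \<Rightarrow> 'a set multiset set \<Rightarrow> 'a set multiset set" where
  "BB_res G K \<xi> = (THE \<eta>. \<exists>\<gamma>s\<in>admissible G.
     \<xi> = BB_proj G (class_tuple G \<gamma>s) \<and>
     \<eta> = BB_proj (G\<lparr>carrier := K\<rparr>)
           (reduce_classes (G\<lparr>carrier := K\<rparr>) (\<Sum>\<gamma>\<leftarrow>\<gamma>s. res_classes G K \<gamma>)))"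

lemma submonoid_submonoid_gen:
  assumes "comm_monoid M" "A \<subseteq> carrier M"
  shows "submonoid (submonoid_gen M A) M"
proof -
  interpret comm_monoid M by fact
  have "submonoid (carrier M) M" by unfold_locales auto
  then have "submonoid_gen M A \<subseteq> carrier M"
    using assms(2) unfolding submonoid_gen_def by blast
  then show ?thesis
    by (rule submonoid.intro)
      (auto simp: submonoid_gen_def submonoid.one_closed intro: submonoid.m_closed)
qed

lemma submonoid_gen_superset: "A \<subseteq> submonoid_gen M A"
  by (auto simp: submonoid_gen_def)

lemma equiv_mquot_rel:
  assumes "comm_monoid M" "submonoid N M"
  shows "equiv (carrier M) (mquot_rel M N)"
proof -
  interpret comm_monoid M by fact
  interpret N: submonoid N M by fact
  have N: "n \<in> carrier M" if "n \<in> N" for n using that N.subset by auto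
  show ?thesis
  proof (rule equivI)
    show "refl_on (carrier M) (mquot_rel M N)"
      by (auto simp: refl_on_def mquot_rel_def intro!: bexI[of _ "\<one>\<^bsub>M\<^esub>"])
    show "sym (mquot_rel M N)" by (rule symI) (auto simp: mquot_rel_def, metis)
    show "trans (mquot_rel M N)"
    proof (rule transI)
      fix a b c assume "(a, b) \<in> mquot_rel M N" "(b, c) \<in> mquot_rel M N"
      then obtain p q r s where *: "a \<in> carrier M" "b \<in> carrier M" "c \<in> carrier M"
          "p \<in> N" "q \<in> N" "r \<in> N" "s \<in> N"
          "a \<otimes>\<^bsub>M\<^esub> p = b \<otimes>\<^bsub>M\<^esub> q" "b \<otimes>\<^bsub>M\<^esub> r = c \<otimes>\<^bsub>M\<^esub> s"
        by (auto simp: mquot_rel_def)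
      have "a \<otimes>\<^bsub>M\<^esub> (p \<otimes>\<^bsub>M\<^esub> r) = (b \<otimes>\<^bsub>M\<^esub> q) \<otimes>\<^bsub>M\<^esub> r" using * N by (metis m_assoc)
      also have "\<dots> = (b \<otimes>\<^bsub>M\<^esub> r) \<otimes>\<^bsub>M\<^esub> q" using *(2,5,6) N by (simp add: m_ac)
      also have "\<dots> = (c \<otimes>\<^bsub>M\<^esub> s) \<otimes>\<^bsub>M\<^esub> q" by (simp only: *(9))
      also have "\<dots> = c \<otimes>\<^bsub>M\<^esub> (s \<otimes>\<^bsub>M\<^esub> q)" using *(3,5,7) N by (simp add: m_assoc)
      finally show "(a, c) \<in> mquot_rel M N" using * unfolding mquot_rel_def by blast
    qed
  qed (auto simp: mquot_rel_def)
qed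

lemma mquot_mult:
  assumes "comm_monoid M" "submonoid N M" "a \<in> carrier M" "b \<in> carrier M"
  shows "mquot_rel M N `` {a} \<otimes>\<^bsub>mquot M N\<^esub> mquot_rel M N `` {b} =
         mquot_rel M N `` {a \<otimes>\<^bsub>M\<^esub> b}"
proof -
  interpret comm_monoid M by fact
  interpret N: submonoid N M by fact
  have N: "n \<in> carrier M" if "n \<in> N" for n using that N.subset by auto
  have "congruent2 (mquot_rel M N) (mquot_rel M N)
          (\<lambda>x y. mquot_rel M N `` {x \<otimes>\<^bsub>M\<^esub> y})"
  proof (rule congruent2I')
    fix a a' b b' assume "(a, a') \<in> mquot_rel M N" "(b, b') \<in> mquot_rel M N"
    then obtain p q r s where *: "a \<in> carrier M" "b \<in> carrier M" "a' \<in> carrier M"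
        "b' \<in> carrier M" "p \<in> N" "q \<in> N" "r \<in> N" "s \<in> N"
        "a \<otimes>\<^bsub>M\<^esub> p = a' \<otimes>\<^bsub>M\<^esub> q" "b \<otimes>\<^bsub>M\<^esub> r = b' \<otimes>\<^bsub>M\<^esub> s"
      by (auto simp: mquot_rel_def)
    have "(a \<otimes>\<^bsub>M\<^esub> b) \<otimes>\<^bsub>M\<^esub> (p \<otimes>\<^bsub>M\<^esub> r) = (a \<otimes>\<^bsub>M\<^esub> p) \<otimes>\<^bsub>M\<^esub> (b \<otimes>\<^bsub>M\<^esub> r)"
      using *(1-8) N by (simp add: m_ac)
    also have "\<dots> = (a' \<otimes>\<^bsub>M\<^esub> b') \<otimes>\<^bsub>M\<^esub> (q \<otimes>\<^bsub>M\<^esub> s)"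
      unfolding *(9,10) using *(1-8) N by (simp add: m_ac)
    finally have "(a \<otimes>\<^bsub>M\<^esub> b, a' \<otimes>\<^bsub>M\<^esub> b') \<in> mquot_rel M N"
      using * unfolding mquot_rel_def by blast
    then show "mquot_rel M N `` {a \<otimes>\<^bsub>M\<^esub> b} = mquot_rel M N `` {a' \<otimes>\<^bsub>M\<^esub> b'}"
      using equiv_class_eq equiv_mquot_rel[OF assms(1,2)] by metis
  qed
  then show ?thesis
    using UN_equiv_class2[OF equiv_mquot_rel[OF assms(1,2)] equiv_mquot_rel[OF assms(1,2)]] assms(3,4)
    by (simp add: mquot_def)
qed

lemma comm_group_mquot:
  assumes M: "comm_monoid M" and N: "submonoid N M"
    and inv: "\<And>a. a \<in> carrier M \<Longrightarrow> \<exists>b\<in>carrier M. a \<otimes>\<^bsub>M\<^esub> b \<in> N"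
  shows "comm_group (mquot M N)"
proof -
  interpret comm_monoid M by fact
  interpret N: submonoid N M by fact
  note eq = equiv_mquot_rel[OF M N]
  let ?c = "\<lambda>a. mquot_rel M N `` {a}"
  have car: "carrier (mquot M N) = ?c ` carrier M"
    by (auto simp: mquot_def quotient_def)
  have one: "\<one>\<^bsub>mquot M N\<^esub> = ?c \<one>\<^bsub>M\<^esub>" by (simp add: mquot_def)
  note mult = mquot_mult[OF M N]
  show ?thesis
  proof (rule comm_groupI)
    fix x assume "x \<in> carrier (mquot M N)"
    then obtain a where a: "a \<in> carrier M" "x = ?c a" by (auto simp: car)
    obtain b where b: "b \<in> carrier M" "a \<otimes>\<^bsub>M\<^esub> b \<in> N" using inv[OF a(1)] by auto
    have "(b \<otimes>\<^bsub>M\<^esub> a) \<otimes>\<^bsub>M\<^esub> \<one>\<^bsub>M\<^esub> = \<one>\<^bsub>M\<^esub> \<otimes>\<^bsub>M\<^esub> (a \<otimes>\<^bsub>M\<^esub> b)"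
      using a b by (simp add: m_comm)
    with a b N.one_closed have "(b \<otimes>\<^bsub>M\<^esub> a, \<one>\<^bsub>M\<^esub>) \<in> mquot_rel M N"
      unfolding mquot_rel_def by blast
    then have "?c (b \<otimes>\<^bsub>M\<^esub> a) = ?c \<one>\<^bsub>M\<^esub>" by (rule equiv_class_eq[OF eq])
    with a b show "\<exists>y\<in>carrier (mquot M N). y \<otimes>\<^bsub>mquot M N\<^esub> x = \<one>\<^bsub>mquot M N\<^esub>"
      by (intro bexI[of _ "?c b"]) (auto simp: car one mult)
  qed (auto simp: car one mult m_ac)
qed

lemma class_tuple_append: "class_tuple G (xs @ ys) = class_tuple G xs + class_tuple G ys"
  by (simp add: class_tuple_def reduce_classes_def)

lemma (in group) foldr_mult_closed:
  "set xs \<subseteq> carrier G \<Longrightarrow> foldr (\<otimes>) xs \<one> \<in> carrier G"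
  by (induction xs) auto

lemma (in group) foldr_mult_append:
  "set xs \<subseteq> carrier G \<Longrightarrow> set ys \<subseteq> carrier G \<Longrightarrow>
   foldr (\<otimes>) (xs @ ys) \<one> = foldr (\<otimes>) xs \<one> \<otimes> foldr (\<otimes>) ys \<one>"
proof (induction xs)
  case Nil
  then show ?case using foldr_mult_closed[of ys] by simp
next
  case (Cons x xs)
  then show ?case using foldr_mult_closed[of xs] foldr_mult_closed[of ys] by (simp add: m_assoc)
qed

lemma (in group) foldr_mult_rev_inv:
  "set xs \<subseteq> carrier G \<Longrightarrow> foldr (\<otimes>) (rev (map (m_inv G) xs)) \<one> = inv (foldr (\<otimes>) xs \<one>)"
proof (induction xs)
  case (Cons x xs)
  have "set (rev (map (m_inv G) xs)) \<subseteq> carrier G" "set [inv x] \<subseteq> carrier G"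
    using Cons.prems by auto
  from foldr_mult_append[OF this] show ?case
    using Cons foldr_mult_closed[of xs] by (simp add: inv_mult_group)
qed simp

lemma (in group) subgroup_derived: "subgroup (derived G (carrier G)) G"
  using derived_is_subgroup[of "carrier G"] by simp

lemma (in group) comm_monoid_Lam: "comm_monoid (Lam G)"
proof (rule comm_monoidI)
  interpret D: subgroup "derived G (carrier G)" G by (rule subgroup_derived)
  fix x y assume "x \<in> carrier (Lam G)" "y \<in> carrier (Lam G)"
  then obtain xs ys where "xs \<in> admissible G" "ys \<in> admissible G"
    "x = class_tuple G xs" "y = class_tuple G ys" by (auto simp: Lam_def)
  then show "x \<otimes>\<^bsub>Lam G\<^esub> y \<in> carrier (Lam G)"
    by (auto simp: Lam_def admissible_def foldr_mult_append class_tuple_append[symmetric]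
        simp del: foldr_append intro!: imageI)
next
  interpret D: subgroup "derived G (carrier G)" G by (rule subgroup_derived)
  show "\<one>\<^bsub>Lam G\<^esub> \<in> carrier (Lam G)"
    by (auto simp: Lam_def admissible_def class_tuple_def reduce_classes_def
        intro!: image_eqI[of _ _ "[]"])
qed (auto simp: Lam_def)

lemma (in group) inv_pairs_subset: "inv_pairs G \<subseteq> carrier (Lam G)"
proof -
  interpret D: subgroup "derived G (carrier G)" G by (rule subgroup_derived)
  show ?thesis by (auto simp: Lam_def admissible_def inv_pairs_def intro!: imageI)
qed

theorem (in group) comm_group_BB: "comm_group (BB G)"
  unfolding BB_def
proof (rule comm_group_mquot)
  interpret D: subgroup "derived G (carrier G)" G by (rule subgroup_derived)
  let ?N = "submonoid_gen (Lam G) (inv_pairs G)"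
  show "comm_monoid (Lam G)" by (rule comm_monoid_Lam)
  show sub: "submonoid ?N (Lam G)"
    by (rule submonoid_submonoid_gen[OF comm_monoid_Lam inv_pairs_subset])
  fix a assume "a \<in> carrier (Lam G)"
  then obtain xs where xs: "xs \<in> admissible G" "a = class_tuple G xs" by (auto simp: Lam_def)
  let ?b = "class_tuple G (rev (map (m_inv G) xs))"
  have "set (rev (map (m_inv G) xs)) \<subseteq> carrier G"
    using xs by (auto simp: admissible_def)
  then have b: "?b \<in> carrier (Lam G)"
    using xs by (auto simp: Lam_def admissible_def foldr_mult_rev_inv
        intro!: imageI)
  have "class_tuple G ys + class_tuple G (rev (map (m_inv G) ys)) \<in> ?N"
    if "set ys \<subseteq> carrier G" for ys
    using that
  proof (induction ys)
    case Nil
    then show ?case using submonoid.one_closed[OF sub]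
      by (simp add: Lam_def class_tuple_def reduce_classes_def)
  next
    case (Cons y ys)
    have "class_tuple G [y, inv y] \<in> ?N"
      using submonoid_gen_superset[of "inv_pairs G" "Lam G"] Cons.prems by (auto simp: inv_pairs_def)
    moreover have "class_tuple G (y # ys) + class_tuple G (rev (map (m_inv G) (y # ys))) =
        class_tuple G [y, inv y] \<otimes>\<^bsub>Lam G\<^esub>
          (class_tuple G ys + class_tuple G (rev (map (m_inv G) ys)))"
      by (simp add: Lam_def class_tuple_def reduce_classes_def)
    ultimately show ?case
      using submonoid.m_closed[OF sub _ Cons.IH] Cons.prems by simp
  qed
  then have "a \<otimes>\<^bsub>Lam G\<^esub> ?b \<in> ?N" using xs by (auto simp: Lam_def admissible_def)
  with b show "\<exists>b\<in>carrier (Lam G). a \<otimes>\<^bsub>Lam G\<^esub> b \<in> ?N" by blast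
qed

end

theory Submission
  imports Defs
begin

text \<open>
  Orbit data are handled through representing lists of group elements. Each of the maps
  replaces a single \<open>\<gamma>\<close> by a list \<open>\<rho> \<gamma>\<close> and a tuple by the concatenation of these lists:
  \<open>\<rho> \<gamma> = [f \<gamma>]\<close> for the map induced by \<open>f\<close>, and for the restriction to \<open>K\<close> the list of the elements
  \<open>t \<gamma>\<^sup>m t\<^sup>-\<^sup>1\<close>, where \<open>t\<close> runs through representatives of the double cosets \<open>K t \<langle>\<gamma>\<rangle>\<close>. The locale
  \<open>tuple_rule\<close> isolates what makes such a rule descend to a homomorphism of the groups of orbit
  data: compatibility with conjugation, with the trivial class and with the relations
  \<open>[\<gamma>, \<gamma>\<^sup>-\<^sup>1] = 0\<close>, and the preservation of the condition that the product of a tuple lies in the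
  commutator subgroup.

  For the restriction, this last condition is the nontrivial one. It holds because the product of
  the \<open>t \<gamma>\<^sup>m t\<^sup>-\<^sup>1\<close>, read in the abelianization of \<open>K\<close>, is the value at \<open>\<gamma>\<close> of the transfer
  homomorphism \<open>G \<rightarrow> K/[K,K]\<close>: the cycles of \<open>\<gamma>\<close> on the cosets \<open>K g\<close> correspond to the double cosets
  \<open>K t \<langle>\<gamma>\<rangle>\<close>, and the contribution of a cycle telescopes (\<open>transfer_eval\<close>). As the transfer is a
  homomorphism to an abelian group, it vanishes on \<open>[G,G]\<close> (\<open>res_tuple_admissible\<close>).

  The formula itself is then a statement about one entry \<open>\<gamma> \<in> H\<close>. If \<open>S\<close> represents the double
  cosets \<open>K s H\<close> and \<open>T s\<close> those of \<open>H\<^sub>s\<close> and \<open>\<langle>s \<gamma> s\<^sup>-\<^sup>1\<rangle>\<close> in \<open>s H s\<^sup>-\<^sup>1\<close>, then the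
  products \<open>u s\<close> with \<open>s \<in> S\<close> and \<open>u \<in> T s\<close> represent the double cosets \<open>K t \<langle>\<gamma>\<rangle>\<close> without repetition
  (\<open>dcoset_transversal_mackey\<close>), and \<open>u\<close> and \<open>u s\<close> contribute the same element
  (\<open>stab_gen_mackey\<close>). Both sides of the formula thus have the same entries.
\<close>

section \<open>Maps of orbit data induced by rules on elements\<close>

lemma class_tuple_Nil [simp]: "class_tuple G [] = {#}"
  by (simp add: class_tuple_def reduce_classes_def)

lemma class_tuple_one [simp]: "class_tuple G [\<one>\<^bsub>G\<^esub>] = {#}"
  by (simp add: class_tuple_def reduce_classes_def)

lemma class_tuple_map_distinct:
  "distinct ts \<Longrightarrow> class_tuple G (map f ts) = (\<Sum>t\<in>set ts. class_tuple G [f t])"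
proof (induction ts)
  case (Cons t ts)
  then show ?case using class_tuple_append[of G "[f t]" "map f ts"] by simp
qed simp

lemma Lam_simps [simp]: "x \<otimes>\<^bsub>Lam G\<^esub> y = x + y" "\<one>\<^bsub>Lam G\<^esub> = {#}"
  by (simp_all add: Lam_def)

context group
begin

lemma conj_by_closed [simp]: "s \<in> carrier G \<Longrightarrow> x \<in> carrier G \<Longrightarrow> conj_by G s x \<in> carrier G"
  by (simp add: conj_by_def)

lemma conj_by_one_left [simp]: "x \<in> carrier G \<Longrightarrow> conj_by G \<one> x = x"
  by (simp add: conj_by_def)

lemma conj_by_one_right [simp]: "s \<in> carrier G \<Longrightarrow> conj_by G s \<one> = \<one>"
  by (simp add: conj_by_def)

lemma conj_by_mult_left:
  "s \<in> carrier G \<Longrightarrow> t \<in> carrier G \<Longrightarrow> x \<in> carrier G \<Longrightarrow>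
   conj_by G (s \<otimes> t) x = conj_by G s (conj_by G t x)"
  by (simp add: conj_by_def inv_mult_group m_assoc)

lemma conj_by_inv_cancel [simp]:
  "s \<in> carrier G \<Longrightarrow> x \<in> carrier G \<Longrightarrow> conj_by G (inv s) (conj_by G s x) = x"
  "s \<in> carrier G \<Longrightarrow> x \<in> carrier G \<Longrightarrow> conj_by G s (conj_by G (inv s) x) = x"
  by (simp_all flip: conj_by_mult_left)

lemma conj_by_mult_right:
  assumes "s \<in> carrier G" "x \<in> carrier G" "y \<in> carrier G"
  shows "conj_by G s (x \<otimes> y) = conj_by G s x \<otimes> conj_by G s y"
proof -
  have "conj_by G s x \<otimes> conj_by G s y = s \<otimes> x \<otimes> (inv s \<otimes> s) \<otimes> y \<otimes> inv s"
    using assms by (simp only: conj_by_def m_assoc m_closed inv_closed)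
  then show ?thesis using assms by (simp add: conj_by_def m_assoc)
qed

lemma conj_by_hom: "s \<in> carrier G \<Longrightarrow> conj_by G s \<in> hom G G"
  by (auto simp: hom_def conj_by_mult_right)

lemma conj_by_inv:
  "s \<in> carrier G \<Longrightarrow> x \<in> carrier G \<Longrightarrow> conj_by G s (inv x) = inv (conj_by G s x)"
  by (simp add: conj_by_def inv_mult_group m_assoc)

lemma conj_by_pow:
  "s \<in> carrier G \<Longrightarrow> x \<in> carrier G \<Longrightarrow> conj_by G s (x [^] (n::nat)) = conj_by G s x [^] n"
  by (induction n) (auto simp: conj_by_mult_right)

lemma conj_by_pow_commute:
  assumes "x \<in> carrier G"
  shows "conj_by G (x [^] (n::nat)) (x [^] (m::nat)) = x [^] m"
proof -
  have "x [^] n \<otimes> x [^] m = x [^] m \<otimes> x [^] n"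
    using assms by (simp add: nat_pow_mult add.commute)
  then show ?thesis using assms by (simp add: conj_by_def m_assoc)
qed

lemma conj_class_conj_by:
  assumes "g \<in> carrier G" "x \<in> carrier G"
  shows "conj_class G (conj_by G g x) = conj_class G x"
proof -
  have "conj_class G (conj_by G h y) \<subseteq> conj_class G y" if "h \<in> carrier G" "y \<in> carrier G" for h y
    using that by (auto simp: conj_class_def simp flip: conj_by_mult_left)
  from this[of "inv g" "conj_by G g x"] this[of g x] assms show ?thesis by auto
qed

lemma conj_class_self: "x \<in> carrier G \<Longrightarrow> x \<in> conj_class G x"
  by (force simp: conj_class_def intro!: image_eqI[of _ _ \<one>])

lemma class_tuple_conj_by:
  "g \<in> carrier G \<Longrightarrow> x \<in> carrier G \<Longrightarrow> class_tuple G [conj_by G g x] = class_tuple G [x]"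
  by (simp add: class_tuple_def conj_class_conj_by)

lemma submonoid_inv_pairs: "submonoid (submonoid_gen (Lam G) (inv_pairs G)) (Lam G)"
  by (rule submonoid_submonoid_gen[OF comm_monoid_Lam inv_pairs_subset])

lemma equiv_BB: "equiv (carrier (Lam G)) (mquot_rel (Lam G) (submonoid_gen (Lam G) (inv_pairs G)))"
  by (rule equiv_mquot_rel[OF comm_monoid_Lam submonoid_inv_pairs])

lemma class_tuple_pair_mem:
  "x \<in> carrier G \<Longrightarrow>
   class_tuple G [x] + class_tuple G [inv x] \<in> submonoid_gen (Lam G) (inv_pairs G)"
  using submonoid_gen_superset[of "inv_pairs G" "Lam G"]
  by (auto simp: inv_pairs_def simp flip: class_tuple_append)

lemma admissible_append:
  assumes "xs \<in> admissible G" "ys \<in> admissible G"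
  shows "xs @ ys \<in> admissible G"
  using assms subgroup.m_closed[OF subgroup_derived]
  by (auto simp: admissible_def foldr_mult_append simp del: foldr_append)

lemma Nil_admissible: "[] \<in> admissible G"
  using subgroup.one_closed[OF subgroup_derived] by (simp add: admissible_def)

lemma inv_pair_admissible: "x \<in> carrier G \<Longrightarrow> [x, inv x] \<in> admissible G"
  using subgroup.one_closed[OF subgroup_derived] by (simp add: admissible_def)

lemma class_tuple_in_Lam: "xs \<in> admissible G \<Longrightarrow> class_tuple G xs \<in> carrier (Lam G)"
  by (simp add: Lam_def)

lemma BB_proj_in_BB: "A \<in> carrier (Lam G) \<Longrightarrow> BB_proj G A \<in> carrier (BB G)"
  by (auto simp: BB_def BB_proj_def mquot_def quotient_def)

lemma BB_mult:
  "A \<in> carrier (Lam G) \<Longrightarrow> B \<in> carrier (Lam G) \<Longrightarrow>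
   BB_proj G A \<otimes>\<^bsub>BB G\<^esub> BB_proj G B = BB_proj G (A + B)"
  unfolding BB_def BB_proj_def
  using mquot_mult[OF comm_monoid_Lam submonoid_inv_pairs] by (simp add: Lam_def)

lemma BB_one: "\<one>\<^bsub>BB G\<^esub> = BB_proj G {#}"
  by (simp add: BB_def BB_proj_def mquot_def Lam_def)

lemma BB_cases:
  assumes "\<xi> \<in> carrier (BB G)"
  obtains \<gamma>s where "\<gamma>s \<in> admissible G" "\<xi> = BB_proj G (class_tuple G \<gamma>s)"
  using assms by (auto simp: BB_def BB_proj_def mquot_def quotient_def Lam_def)

lemma finprod_BB:
  assumes "finite S" "\<And>s. s \<in> S \<Longrightarrow> A s \<in> carrier (Lam G)"
  shows "(\<Otimes>\<^bsub>BB G\<^esub>s\<in>S. BB_proj G (A s)) = BB_proj G (\<Sum>s\<in>S. A s) \<and>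
         (\<Sum>s\<in>S. A s) \<in> carrier (Lam G)"
proof -
  interpret BB: comm_group "BB G" by (rule comm_group_BB)
  interpret L: comm_monoid "Lam G" by (rule comm_monoid_Lam)
  show ?thesis
    using assms
  proof (induction S)
    case empty
    then show ?case using L.one_closed by (simp add: BB_one)
  next
    case (insert s S)
    then have "A s + (\<Sum>s\<in>S. A s) \<in> carrier (Lam G)"
      using L.m_closed[of "A s" "\<Sum>s\<in>S. A s"] by (simp add: Lam_def)
    moreover have "(\<lambda>s. BB_proj G (A s)) \<in> S \<rightarrow> carrier (BB G)"
      using insert.prems by (auto intro: BB_proj_in_BB)
    ultimately show ?case using insert by (simp add: BB_proj_in_BB BB_mult)
  qed
qed

end

text \<open>
  The common shape of the maps of orbit data: the list \<open>\<rho> \<gamma>\<close> holds representatives of the entries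
  that replace the class of \<open>\<gamma>\<close>. Lists are used because the condition on the product in the
  definition of orbit data is about representing elements.
\<close>
definition induced_map ::
  "('a, 'm) monoid_scheme \<Rightarrow> ('b, 'n) monoid_scheme \<Rightarrow> ('a \<Rightarrow> 'b list) \<Rightarrow>
   'a set multiset set \<Rightarrow> 'b set multiset set" where
  "induced_map H G \<rho> \<xi> = (THE \<eta>. \<exists>\<gamma>s\<in>admissible H.
     \<xi> = BB_proj H (class_tuple H \<gamma>s) \<and> \<eta> = BB_proj G (class_tuple G (concat (map \<rho> \<gamma>s))))"

locale tuple_rule = H: group H + G: group G
  for H :: "('a, 'm) monoid_scheme" and G :: "('b, 'n) monoid_scheme" +
  fixes \<rho> :: "'a \<Rightarrow> 'b list"
  assumes admissible: "\<gamma>s \<in> admissible H \<Longrightarrow> concat (map \<rho> \<gamma>s) \<in> admissible G"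
    and conj: "\<lbrakk>g \<in> carrier H; x \<in> carrier H\<rbrakk> \<Longrightarrow>
      class_tuple G (\<rho> (conj_by H g x)) = class_tuple G (\<rho> x)"
    and one: "class_tuple G (\<rho> \<one>\<^bsub>H\<^esub>) = {#}"
    and inv: "x \<in> carrier H \<Longrightarrow>
      class_tuple G (\<rho> x) + class_tuple G (\<rho> (inv\<^bsub>H\<^esub> x)) \<in> submonoid_gen (Lam G) (inv_pairs G)"
begin

abbreviation image_tuple :: "'a list \<Rightarrow> 'b set multiset" where
  "image_tuple \<gamma>s \<equiv> class_tuple G (concat (map \<rho> \<gamma>s))"

lemma image_tuple_append: "image_tuple (xs @ ys) = image_tuple xs + image_tuple ys"
  by (simp add: class_tuple_append)

text \<open>
  The image is a sum over the multiset of classes of a function of the class: choosing any element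
  of a class gives the same value by \<open>conj\<close>, and the class of the identity, which may have been
  removed, contributes nothing by \<open>one\<close>.
\<close>
lemma image_tuple_cong:
  assumes "set xs \<subseteq> carrier H" "set ys \<subseteq> carrier H" "class_tuple H xs = class_tuple H ys"
  shows "image_tuple xs = image_tuple ys"
proof -
  define \<phi> where "\<phi> C = class_tuple G (\<rho> (SOME x. x \<in> C))" for C
  have \<phi>: "\<phi> (conj_class H x) = class_tuple G (\<rho> x)" if "x \<in> carrier H" for x
  proof -
    have "(SOME y. y \<in> conj_class H x) \<in> conj_class H x"
      using H.conj_class_self[OF that] by (rule someI)
    then show ?thesis using conj that by (auto simp: \<phi>_def conj_class_def)
  qed
  have reduce: "sum_mset (image_mset \<phi> (reduce_classes H A)) = sum_mset (image_mset \<phi> A)" for A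
    using \<phi>[OF H.one_closed] one by (induction A) (auto simp: reduce_classes_def)
  have "image_tuple zs = sum_mset (image_mset \<phi> (class_tuple H zs))"
    if "set zs \<subseteq> carrier H" for zs
  proof -
    have "image_tuple zs = (\<Sum>z\<leftarrow>zs. \<phi> (conj_class H z))"
      using that \<phi> by (induction zs) (auto simp: class_tuple_append)
    also have "\<dots> = sum_mset (image_mset \<phi> (mset (map (conj_class H) zs)))"
      by (simp add: sum_mset_sum_list[symmetric] image_mset.compositionality comp_def)
    finally show ?thesis by (simp add: class_tuple_def reduce)
  qed
  with assms show ?thesis by simp
qed

text \<open>
  The elements with the asserted property form a submonoid that contains the generating pairs. A
  representing list is kept because the image is computed from lists.
\<close>
lemma pair_submonoid_image:
  assumes "n \<in> submonoid_gen (Lam H) (inv_pairs H)"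
  shows "\<exists>zs\<in>admissible H. n = class_tuple H zs \<and>
           image_tuple zs \<in> submonoid_gen (Lam G) (inv_pairs G)"
proof -
  let ?P = "class_tuple H ` {zs \<in> admissible H. image_tuple zs \<in> submonoid_gen (Lam G) (inv_pairs G)}"
  note NG = G.submonoid_inv_pairs
  have NG_add: "a + b \<in> submonoid_gen (Lam G) (inv_pairs G)"
    if "a \<in> submonoid_gen (Lam G) (inv_pairs G)" "b \<in> submonoid_gen (Lam G) (inv_pairs G)" for a b
    using submonoid.m_closed[OF NG that] by (simp add: Lam_def)
  have "submonoid ?P (Lam H)"
  proof
    show "?P \<subseteq> carrier (Lam H)" by (auto simp: Lam_def)
    show "\<one>\<^bsub>Lam H\<^esub> \<in> ?P"
      using submonoid.one_closed[OF NG] H.Nil_admissible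
      by (auto intro!: image_eqI[of _ _ "[]"])
    fix x y assume "x \<in> ?P" "y \<in> ?P"
    then obtain xs ys where *: "xs \<in> admissible H" "ys \<in> admissible H"
        "x = class_tuple H xs" "y = class_tuple H ys"
        "image_tuple xs \<in> submonoid_gen (Lam G) (inv_pairs G)"
        "image_tuple ys \<in> submonoid_gen (Lam G) (inv_pairs G)" by auto
    then show "x \<otimes>\<^bsub>Lam H\<^esub> y \<in> ?P"
      by (intro image_eqI[of _ _ "xs @ ys"])
        (auto simp: class_tuple_append H.admissible_append intro: NG_add)
  qed
  moreover have "inv_pairs H \<subseteq> ?P"
    using inv H.inv_pair_admissible
    by (auto simp: inv_pairs_def[of H] class_tuple_append intro!: imageI)
  ultimately show ?thesis using assms by (auto simp: submonoid_gen_def)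
qed

text \<open>
  Tuples with the same projection become equal after pairs are added on both sides, and the images of
  these pairs vanish in the target. This makes the definite description in \<open>induced_map\<close> meaningful.
\<close>
lemma BB_proj_image_cong:
  assumes xs: "xs \<in> admissible H" and ys: "ys \<in> admissible H"
    and eq: "BB_proj H (class_tuple H xs) = BB_proj H (class_tuple H ys)"
  shows "BB_proj G (image_tuple xs) = BB_proj G (image_tuple ys)"
proof -
  from eq have "(class_tuple H xs, class_tuple H ys)
      \<in> mquot_rel (Lam H) (submonoid_gen (Lam H) (inv_pairs H))"
    unfolding BB_proj_def using eq_equiv_class[OF _ H.equiv_BB] H.class_tuple_in_Lam ys by blast
  then obtain n n' where n: "n \<in> submonoid_gen (Lam H) (inv_pairs H)"
      "n' \<in> submonoid_gen (Lam H) (inv_pairs H)" "class_tuple H xs + n = class_tuple H ys + n'"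
    by (auto simp: mquot_rel_def Lam_def)
  obtain zs zs' where z: "zs \<in> admissible H" "zs' \<in> admissible H"
      "n = class_tuple H zs" "n' = class_tuple H zs'"
      "image_tuple zs \<in> submonoid_gen (Lam G) (inv_pairs G)"
      "image_tuple zs' \<in> submonoid_gen (Lam G) (inv_pairs G)"
    using pair_submonoid_image[OF n(1)] pair_submonoid_image[OF n(2)] by blast
  have "image_tuple (xs @ zs) = image_tuple (ys @ zs')"
    using n z xs ys by (intro image_tuple_cong) (auto simp: admissible_def class_tuple_append)
  then have "(image_tuple xs, image_tuple ys)
      \<in> mquot_rel (Lam G) (submonoid_gen (Lam G) (inv_pairs G))"
    using z G.class_tuple_in_Lam[OF admissible] xs ys
    unfolding image_tuple_append by (auto simp: mquot_rel_def Lam_def)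
  then show ?thesis unfolding BB_proj_def by (rule equiv_class_eq[OF G.equiv_BB])
qed

lemma induced_map_proj:
  assumes "\<gamma>s \<in> admissible H"
  shows "induced_map H G \<rho> (BB_proj H (class_tuple H \<gamma>s)) = BB_proj G (image_tuple \<gamma>s)"
  unfolding induced_map_def
proof (rule the_equality)
  fix \<eta>
  assume "\<exists>\<gamma>s'\<in>admissible H. BB_proj H (class_tuple H \<gamma>s) = BB_proj H (class_tuple H \<gamma>s') \<and>
      \<eta> = BB_proj G (image_tuple \<gamma>s')"
  then obtain \<gamma>s' where "\<gamma>s' \<in> admissible H" "\<eta> = BB_proj G (image_tuple \<gamma>s')"
      "BB_proj H (class_tuple H \<gamma>s) = BB_proj H (class_tuple H \<gamma>s')" by blast
  then show "\<eta> = BB_proj G (image_tuple \<gamma>s)" using BB_proj_image_cong[OF assms] by simp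
qed (use assms in blast)

lemma induced_map_hom: "induced_map H G \<rho> \<in> hom (BB H) (BB G)"
proof (rule homI)
  fix \<xi> assume "\<xi> \<in> carrier (BB H)"
  then obtain xs where "xs \<in> admissible H" "\<xi> = BB_proj H (class_tuple H xs)" by (rule H.BB_cases)
  then show "induced_map H G \<rho> \<xi> \<in> carrier (BB G)"
    by (simp add: induced_map_proj G.BB_proj_in_BB G.class_tuple_in_Lam admissible)
next
  fix \<xi> \<zeta> assume "\<xi> \<in> carrier (BB H)" "\<zeta> \<in> carrier (BB H)"
  then obtain xs ys where *: "xs \<in> admissible H" "\<xi> = BB_proj H (class_tuple H xs)"
      "ys \<in> admissible H" "\<zeta> = BB_proj H (class_tuple H ys)" by (metis H.BB_cases)
  then have "\<xi> \<otimes>\<^bsub>BB H\<^esub> \<zeta> = BB_proj H (class_tuple H (xs @ ys))"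
    by (simp add: H.BB_mult H.class_tuple_in_Lam class_tuple_append)
  then show "induced_map H G \<rho> (\<xi> \<otimes>\<^bsub>BB H\<^esub> \<zeta>)
      = induced_map H G \<rho> \<xi> \<otimes>\<^bsub>BB G\<^esub> induced_map H G \<rho> \<zeta>"
    using * by (simp only: induced_map_proj H.admissible_append image_tuple_append
        G.BB_mult G.class_tuple_in_Lam admissible)
qed

end

lemma (in group_hom) foldr_mult_hom:
  "set xs \<subseteq> carrier G \<Longrightarrow> foldr (\<otimes>\<^bsub>H\<^esub>) (map h xs) \<one>\<^bsub>H\<^esub> = h (foldr (\<otimes>) xs \<one>)"
  by (induction xs) (auto simp: G.foldr_mult_closed)

lemma (in group_hom) hom_derived_mem: "x \<in> derived G (carrier G) \<Longrightarrow> h x \<in> derived H (carrier H)"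
  using derived_img[of "carrier G"] H.mono_derived[of "h ` carrier G" "carrier H"] hom_closed
  by blast

lemma (in group_hom) tuple_rule_hom: "tuple_rule G H (\<lambda>x. [h x])"
proof unfold_locales
  fix \<gamma>s assume "\<gamma>s \<in> admissible G"
  then show "concat (map (\<lambda>x. [h x]) \<gamma>s) \<in> admissible H"
    by (auto simp: admissible_def foldr_mult_hom hom_derived_mem)
next
  fix g x assume "g \<in> carrier G" "x \<in> carrier G"
  then show "class_tuple H [h (conj_by G g x)] = class_tuple H [h x]"
    using H.class_tuple_conj_by[of "h g" "h x"] by (simp add: conj_by_def)
qed (use H.class_tuple_pair_mem in auto)

lemma BB_map_eq_induced_map: "BB_map H G f = induced_map H G (\<lambda>x. [f x])"
  by (simp add: BB_map_def induced_map_def fun_eq_iff)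

section \<open>Transversals of double cosets\<close>

text \<open>
  The entries of a restricted tuple are indexed by double cosets. Working with an arbitrary choice
  of representatives, instead of with the cosets as sets, turns each comparison of two index sets
  into the construction of one transversal from another.
\<close>
definition dcoset_transversal :: "('a, 'm) monoid_scheme \<Rightarrow> 'a set \<Rightarrow> 'a set \<Rightarrow> 'a set \<Rightarrow> bool" where
  "dcoset_transversal G A B T \<longleftrightarrow>
     T \<subseteq> carrier G \<and> (\<forall>g\<in>carrier G. \<exists>!t. t \<in> T \<and> g \<in> dcoset G A t B)"

lemma mem_dcoset: "g \<in> dcoset G A t B \<longleftrightarrow> (\<exists>a\<in>A. \<exists>b\<in>B. g = a \<otimes>\<^bsub>G\<^esub> t \<otimes>\<^bsub>G\<^esub> b)"
  by (auto simp: dcoset_def r_coset_def set_mult_def)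

lemma dcosetI: "\<lbrakk>a \<in> A; b \<in> B; g = a \<otimes>\<^bsub>G\<^esub> t \<otimes>\<^bsub>G\<^esub> b\<rbrakk> \<Longrightarrow> g \<in> dcoset G A t B"
  by (auto simp: mem_dcoset)

lemma dcoset_transversalD:
  assumes "dcoset_transversal G A B T"
  shows "t \<in> T \<Longrightarrow> t \<in> carrier G"
    and "g \<in> carrier G \<Longrightarrow> \<exists>t\<in>T. g \<in> dcoset G A t B"
    and "\<lbrakk>t \<in> T; t' \<in> T; g \<in> carrier G; g \<in> dcoset G A t B; g \<in> dcoset G A t' B\<rbrakk> \<Longrightarrow> t = t'"
  using assms by (auto simp: dcoset_transversal_def)

context group
begin

lemma dcoset_self:
  assumes "subgroup A G" "subgroup B G" "t \<in> carrier G"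
  shows "t \<in> dcoset G A t B"
  using assms by (intro dcosetI[of \<one> _ \<one>]) (auto intro: subgroup.one_closed)

lemma dcoset_eq:
  assumes A: "subgroup A G" and B: "subgroup B G"
    and t: "t \<in> carrier G" and g: "g \<in> dcoset G A t B"
  shows "dcoset G A g B = dcoset G A t B"
proof -
  have sub: "dcoset G A y B \<subseteq> dcoset G A x B" if x: "x \<in> carrier G" and y: "y \<in> dcoset G A x B" for x y
  proof
    fix z assume "z \<in> dcoset G A y B"
    then obtain a b a' b' where *: "a \<in> A" "b \<in> B" "a' \<in> A" "b' \<in> B"
        "y = a \<otimes> x \<otimes> b" "z = a' \<otimes> y \<otimes> b'" using y by (auto simp: mem_dcoset)
    then have "z = (a' \<otimes> a) \<otimes> x \<otimes> (b \<otimes> b')"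
      using x A B by (simp add: m_assoc subgroup.mem_carrier)
    moreover have "a' \<otimes> a \<in> A" "b \<otimes> b' \<in> B"
      using * A B by (auto intro: subgroup.m_closed)
    ultimately show "z \<in> dcoset G A x B" by (intro dcosetI)
  qed
  obtain a b where *: "a \<in> A" "b \<in> B" "g = a \<otimes> t \<otimes> b" using g by (auto simp: mem_dcoset)
  then have carr: "a \<in> carrier G" "b \<in> carrier G" using A B by (auto simp: subgroup.mem_carrier)
  then have "t = inv a \<otimes> g \<otimes> inv b"
    using * t by (simp add: m_assoc inv_solve_left)
  then have "t \<in> dcoset G A g B"
    using * A B by (intro dcosetI[of "inv a" _ "inv b"]) (auto intro: subgroup.m_inv_closed)
  moreover have "g \<in> carrier G" using * carr t by simp
  ultimately show ?thesis using sub[OF t g] sub[of g t] by blast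
qed

lemma dcoset_transversal_exists:
  assumes A: "subgroup A G" and B: "subgroup B G"
  shows "\<exists>T. dcoset_transversal G A B T"
proof -
  define c where "c t = (SOME x. x \<in> dcoset G A t B)" for t
  have c: "c t \<in> dcoset G A t B" if "t \<in> carrier G" for t
    unfolding c_def using dcoset_self[OF A B that] by (rule someI)
  have closed: "c t \<in> carrier G" if "t \<in> carrier G" for t
    using c[OF that] that A B by (auto simp: mem_dcoset subgroup.mem_carrier)
  have c_eq: "c x = c t" if "t \<in> carrier G" "x \<in> dcoset G A t B" for x t
    using dcoset_eq[OF A B that] by (simp add: c_def)
  have "dcoset_transversal G A B (c ` carrier G)"
    unfolding dcoset_transversal_def
  proof (intro conjI ballI)
    show "c ` carrier G \<subseteq> carrier G" using closed by auto
    fix g assume g: "g \<in> carrier G"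
    show "\<exists>!t. t \<in> c ` carrier G \<and> g \<in> dcoset G A t B"
    proof (rule ex1I[of _ "c g"])
      show "c g \<in> c ` carrier G \<and> g \<in> dcoset G A (c g) B"
        using g dcoset_eq[OF A B g c[OF g]] dcoset_self[OF A B g] by auto
      fix t assume "t \<in> c ` carrier G \<and> g \<in> dcoset G A t B"
      then obtain x where x: "x \<in> carrier G" "t = c x" "g \<in> dcoset G A t B" by auto
      then show "t = c g"
        using c_eq[of t g] closed c_eq[OF x(1) c[OF x(1)]] by simp
    qed
  qed
  then show ?thesis ..
qed

lemma dcoset_transversal_inj_on:
  assumes "subgroup A G" "subgroup B G" "dcoset_transversal G A B T"
  shows "inj_on (\<lambda>t. dcoset G A t B) T"
proof (rule inj_onI)
  fix t t' assume *: "t \<in> T" "t' \<in> T" "dcoset G A t B = dcoset G A t' B"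
  have "t \<in> carrier G" using dcoset_transversalD(1)[OF assms(3) *(1)] .
  then show "t = t'"
    using dcoset_transversalD(3)[OF assms(3) *(1,2), of t] dcoset_self[OF assms(1,2), of t] *(3) by simp
qed

lemma dcoset_transversal_image:
  assumes "subgroup A G" "subgroup B G" "dcoset_transversal G A B T"
  shows "(\<lambda>t. dcoset G A t B) ` T = (\<lambda>t. dcoset G A t B) ` carrier G"
proof
  show "(\<lambda>t. dcoset G A t B) ` T \<subseteq> (\<lambda>t. dcoset G A t B) ` carrier G"
    using dcoset_transversalD(1)[OF assms(3)] by auto
  show "(\<lambda>t. dcoset G A t B) ` carrier G \<subseteq> (\<lambda>t. dcoset G A t B) ` T"
  proof (rule image_subsetI)
    fix g assume "g \<in> carrier G"
    then obtain t where t: "t \<in> T" "g \<in> dcoset G A t B"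
      using dcoset_transversalD(2)[OF assms(3)] by blast
    then show "dcoset G A g B \<in> (\<lambda>t. dcoset G A t B) ` T"
      using dcoset_eq[OF assms(1,2) _ t(2)] dcoset_transversalD(1)[OF assms(3)] by simp
  qed
qed

text \<open>
  \<open>A (t g\<^sup>-\<^sup>1) (g B g\<^sup>-\<^sup>1) = (A t B) g\<^sup>-\<^sup>1\<close>.
\<close>
lemma dcoset_transversal_translate:
  assumes A: "A \<subseteq> carrier G" and B: "B \<subseteq> carrier G" and T: "dcoset_transversal G A B T"
    and g: "g \<in> carrier G"
  shows "dcoset_transversal G A (conj_by G g ` B) ((\<lambda>t. t \<otimes> inv g) ` T)"
proof -
  have iff: "x \<in> dcoset G A (t \<otimes> inv g) (conj_by G g ` B) \<longleftrightarrow> x \<otimes> g \<in> dcoset G A t B"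
    if x: "x \<in> carrier G" and t: "t \<in> carrier G" for x t
  proof -
    have "x = a \<otimes> (t \<otimes> inv g) \<otimes> conj_by G g b \<longleftrightarrow> x \<otimes> g = a \<otimes> t \<otimes> b"
      if "a \<in> A" "b \<in> B" for a b
    proof -
      have ab: "a \<in> carrier G" "b \<in> carrier G" using that A B by auto
      have "a \<otimes> (t \<otimes> inv g) \<otimes> conj_by G g b = a \<otimes> t \<otimes> (inv g \<otimes> g) \<otimes> b \<otimes> inv g"
        using ab t g by (simp only: conj_by_def m_assoc m_closed inv_closed)
      also have "\<dots> = (a \<otimes> t \<otimes> b) \<otimes> inv g" using ab t g by (simp add: m_assoc)
      finally show ?thesis using inv_solve_right[of x "a \<otimes> t \<otimes> b" g] ab t g x by auto
    qed
    then show ?thesis by (auto simp: mem_dcoset)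
  qed
  show ?thesis
    unfolding dcoset_transversal_def
  proof (intro conjI ballI)
    show "(\<lambda>t. t \<otimes> inv g) ` T \<subseteq> carrier G" using dcoset_transversalD(1)[OF T] g by auto
    fix x assume x: "x \<in> carrier G"
    then obtain t where t: "t \<in> T" "x \<otimes> g \<in> dcoset G A t B"
      using dcoset_transversalD(2)[OF T, of "x \<otimes> g"] g by auto
    show "\<exists>!t. t \<in> (\<lambda>t. t \<otimes> inv g) ` T \<and> x \<in> dcoset G A t (conj_by G g ` B)"
    proof (rule ex1I[of _ "t \<otimes> inv g"])
      show "t \<otimes> inv g \<in> (\<lambda>t. t \<otimes> inv g) ` T \<and>
          x \<in> dcoset G A (t \<otimes> inv g) (conj_by G g ` B)"
        using t iff[OF x] dcoset_transversalD(1)[OF T] g by simp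
      fix t' assume "t' \<in> (\<lambda>t. t \<otimes> inv g) ` T \<and> x \<in> dcoset G A t' (conj_by G g ` B)"
      then obtain r where r: "r \<in> T" "t' = r \<otimes> inv g" "x \<otimes> g \<in> dcoset G A r B"
        using iff[OF x] dcoset_transversalD(1)[OF T] by blast
      then show "t' = t \<otimes> inv g"
        using dcoset_transversalD(3)[OF T r(1) t(1) _ r(3) t(2)] g x by simp
    qed
  qed
qed

lemma conj_by_generate:
  assumes "g \<in> carrier G" "x \<in> carrier G"
  shows "generate G {conj_by G g x} = conj_by G g ` generate G {x}"
proof -
  interpret c: group_hom G G "conj_by G g"
    using assms by unfold_locales (simp add: conj_by_hom)
  show ?thesis using c.generate_img[of "{x}"] assms by simp
qed

text \<open>
  The double coset \<open>K s H\<close> is a union of double cosets of \<open>K\<close> and \<open>Z\<close>, and right multiplication by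
  \<open>s\<close> identifies these with the double cosets of \<open>s H s\<^sup>-\<^sup>1 \<inter> K\<close> and \<open>s Z s\<^sup>-\<^sup>1\<close> in \<open>s H s\<^sup>-\<^sup>1\<close>. Two elements
  \<open>u, u' \<in> s H s\<^sup>-\<^sup>1\<close> with \<open>K u s Z = K u' s Z\<close> satisfy \<open>u = l u' (s y s\<^sup>-\<^sup>1)\<close> with \<open>l \<in> K\<close> and \<open>y \<in> Z\<close>; then
  \<open>l\<close> also lies in \<open>s H s\<^sup>-\<^sup>1\<close>, because the other factors do.
\<close>
lemma dcoset_transversal_mackey:
  fixes T :: "'a \<Rightarrow> 'a set"
  assumes H: "subgroup H G" and K: "subgroup K G" and Z: "subgroup Z G" "Z \<subseteq> H"
    and S: "dcoset_transversal G K H S"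
    and T: "\<And>s. s \<in> S \<Longrightarrow>
      dcoset_transversal (G\<lparr>carrier := conj_by G s ` H\<rparr>) (conj_by G s ` H \<inter> K) (conj_by G s ` Z) (T s)"
  shows "inj_on (\<lambda>(s, u). u \<otimes> s) (Sigma S T)"
    and "dcoset_transversal G K Z ((\<lambda>(s, u). u \<otimes> s) ` Sigma S T)"
proof -
  note Sc = dcoset_transversalD(1)[OF S]
  have Tc: "\<exists>h\<in>H. u = conj_by G s h" if "s \<in> S" "u \<in> T s" for s u
    using dcoset_transversalD(1)[OF T] that by fastforce
  have Hc: "h \<in> carrier G" if "h \<in> H" for h using that H by (rule subgroup.mem_carrier[rotated])
  have Kc: "h \<in> carrier G" if "h \<in> K" for h using that K by (rule subgroup.mem_carrier[rotated])
  have Zc: "h \<in> carrier G" if "h \<in> Z" for h using that Z Hc by auto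
  have us: "conj_by G s h \<otimes> s = s \<otimes> h" if "s \<in> S" "h \<in> H" for s h
    using that Sc Hc by (simp add: conj_by_def m_assoc)
  have Tcar: "u \<in> carrier G" if "s \<in> S" "u \<in> T s" for s u
    using Tc[OF that] that Sc Hc by auto
  have uniq: "s = s' \<and> u = u'"
    if s: "s \<in> S" "s' \<in> S" and u: "u \<in> T s" "u' \<in> T s'" and x: "x \<in> carrier G"
      and mem: "x \<in> dcoset G K (u \<otimes> s) Z" "x \<in> dcoset G K (u' \<otimes> s') Z" for s s' u u' x
  proof -
    have in_big: "x \<in> dcoset G K r H" if rw: "r \<in> S" "w \<in> T r" "x \<in> dcoset G K (w \<otimes> r) Z" for r w
    proof -
      obtain h k z where *: "h \<in> H" "w = conj_by G r h" "k \<in> K" "z \<in> Z" "x = k \<otimes> (w \<otimes> r) \<otimes> z"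
        using Tc[OF rw(1,2)] rw(3) by (auto simp: mem_dcoset)
      then have "x = k \<otimes> r \<otimes> (h \<otimes> z)"
        using rw us Sc Hc Kc Zc by (simp add: m_assoc)
      moreover have "h \<otimes> z \<in> H" using * Z H by (auto intro: subgroup.m_closed)
      ultimately show ?thesis using * by (auto simp: mem_dcoset)
    qed
    have ss: "s = s'"
      using dcoset_transversalD(3)[OF S s x in_big[OF s(1) u(1) mem(1)] in_big[OF s(2) u(2) mem(2)]] .
    let ?G = "G\<lparr>carrier := conj_by G s ` H\<rparr>"
    have sc: "s \<in> carrier G" using s Sc by auto
    interpret cs: group_hom G G "conj_by G s" using sc by unfold_locales (simp add: conj_by_hom)
    have cH: "subgroup (conj_by G s ` H) G" by (rule cs.subgroup_img_is_subgroup[OF H])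
    have cZ: "subgroup (conj_by G s ` Z) G" by (rule cs.subgroup_img_is_subgroup[OF Z(1)])
    obtain k z k' z' where kz: "k \<in> K" "z \<in> Z" "x = k \<otimes> (u \<otimes> s) \<otimes> z"
        "k' \<in> K" "z' \<in> Z" "x = k' \<otimes> (u' \<otimes> s) \<otimes> z'"
      using mem ss by (auto simp: mem_dcoset)
    \<comment> \<open>Solving \<open>k (u s) z = k' (u' s) z'\<close> for \<open>u\<close> gives \<open>u = l u' (s y s\<^sup>-\<^sup>1)\<close>.\<close>
    define l where "l = inv k \<otimes> k'"
    define y where "y = z' \<otimes> inv z"
    have l: "l \<in> K" unfolding l_def using kz K by (auto intro: subgroup.m_closed subgroup.m_inv_closed)
    have y: "y \<in> Z" unfolding y_def using kz Z by (auto intro: subgroup.m_closed subgroup.m_inv_closed)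
    note car = sc Kc[OF l] Zc[OF y] Kc[OF kz(1)] Kc[OF kz(4)] Zc[OF kz(2)] Zc[OF kz(5)]
      Tcar[OF s(1) u(1)] Tcar[OF s(2) u(2)]
    have "k \<otimes> (u \<otimes> s) = k' \<otimes> (u' \<otimes> s) \<otimes> z' \<otimes> inv z"
      using kz(3,6) car by (simp add: inv_solve_right)
    then have "u \<otimes> s = inv k \<otimes> (k' \<otimes> (u' \<otimes> s) \<otimes> z' \<otimes> inv z)"
      using car by (simp add: inv_solve_left)
    also have "\<dots> = l \<otimes> u' \<otimes> (s \<otimes> y)"
      using car by (simp add: l_def y_def m_assoc)
    finally have "u = l \<otimes> u' \<otimes> (s \<otimes> y) \<otimes> inv s" using car by (simp add: inv_solve_right)
    then have ueq: "u = l \<otimes> u' \<otimes> conj_by G s y" using car by (simp add: conj_by_def m_assoc)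
    have uH: "u \<in> conj_by G s ` H" "u' \<in> conj_by G s ` H"
      using Tc[OF s(1) u(1)] Tc[OF s(2) u(2)] ss by auto
    have yH: "conj_by G s y \<in> conj_by G s ` H" using y Z by auto
    have "l = u \<otimes> inv (u' \<otimes> conj_by G s y)"
      using ueq car by (simp add: inv_solve_right m_assoc)
    then have "l \<in> conj_by G s ` H"
      using uH yH cH by (simp add: subgroup.m_closed subgroup.m_inv_closed)
    then have mem1: "u \<in> dcoset ?G (conj_by G s ` H \<inter> K) u' (conj_by G s ` Z)"
      using l y ueq by (auto simp: mem_dcoset)
    have "\<one> \<in> conj_by G s ` H \<inter> K" "\<one> \<in> conj_by G s ` Z"
      using cH cZ K subgroup.one_closed by auto
    then have mem2: "u \<in> dcoset ?G (conj_by G s ` H \<inter> K) u (conj_by G s ` Z)"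
      using car by (intro dcosetI[of \<one> _ \<one>]) auto
    show ?thesis
      using dcoset_transversalD(3)[OF T[OF s(1)] u(1) _ _ mem2 mem1] u(2) ss uH by simp
  qed
  have self: "u \<otimes> s \<in> dcoset G K (u \<otimes> s) Z" if "s \<in> S" "u \<in> T s" for s u
    using that Sc Tcar dcoset_self[OF K Z(1)] by simp
  show "inj_on (\<lambda>(s, u). u \<otimes> s) (Sigma S T)"
  proof (rule inj_onI; clarsimp)
    fix s u s' u' assume *: "s \<in> S" "u \<in> T s" "s' \<in> S" "u' \<in> T s'" "u \<otimes> s = u' \<otimes> s'"
    then show "s = s' \<and> u = u'"
      using uniq[of s s' u u' "u \<otimes> s"] self[of s u] self[of s' u'] Sc Tcar by simp
  qed
  show "dcoset_transversal G K Z ((\<lambda>(s, u). u \<otimes> s) ` Sigma S T)"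
    unfolding dcoset_transversal_def
  proof (intro conjI ballI)
    show "(\<lambda>(s, u). u \<otimes> s) ` Sigma S T \<subseteq> carrier G" using Sc Tcar by auto
    fix x assume x: "x \<in> carrier G"
    obtain s k h where s: "s \<in> S" and kh: "k \<in> K" "h \<in> H" "x = k \<otimes> s \<otimes> h"
      using dcoset_transversalD(2)[OF S x] by (auto simp: mem_dcoset)
    obtain u l z where u: "u \<in> T s" "l \<in> K" "z \<in> Z" "conj_by G s h = l \<otimes> u \<otimes> conj_by G s z"
      using dcoset_transversalD(2)[OF T[OF s], of "conj_by G s h"] kh by (auto simp: mem_dcoset)
    note car = Sc[OF s] Kc[OF kh(1)] Hc[OF kh(2)] Tcar[OF s u(1)] Kc[OF u(2)] Zc[OF u(3)]
    have "x = k \<otimes> (conj_by G s h \<otimes> s)" using kh us s car by (simp add: m_assoc)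
    also have "\<dots> = k \<otimes> (l \<otimes> u \<otimes> (conj_by G s z \<otimes> s))" using u(4) car by (simp add: m_assoc)
    also have "\<dots> = (k \<otimes> l) \<otimes> (u \<otimes> s) \<otimes> z"
      using us[OF s, of z] u(3) Z(2) car by (simp add: m_assoc subset_iff)
    finally have mem: "x \<in> dcoset G K (u \<otimes> s) Z"
      using kh u K by (intro dcosetI[of "k \<otimes> l" _ z]) (auto intro: subgroup.m_closed)
    show "\<exists>!t. t \<in> (\<lambda>(s, u). u \<otimes> s) ` Sigma S T \<and> x \<in> dcoset G K t Z"
    proof (rule ex1I[of _ "u \<otimes> s"])
      show "u \<otimes> s \<in> (\<lambda>(s, u). u \<otimes> s) ` Sigma S T \<and> x \<in> dcoset G K (u \<otimes> s) Z"
        using s u(1) mem by (auto intro!: image_eqI[of _ _ "(s, u)"])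
      fix t assume "t \<in> (\<lambda>(s, u). u \<otimes> s) ` Sigma S T \<and> x \<in> dcoset G K t Z"
      then obtain s' u' where t: "s' \<in> S" "u' \<in> T s'" "t = u' \<otimes> s'" "x \<in> dcoset G K (u' \<otimes> s') Z"
        by auto
      then show "t = u \<otimes> s" using uniq[OF t(1) s t(2) u(1) x t(4) mem] by simp
    qed
  qed
qed

end

section \<open>The entries of a restricted tuple\<close>

text \<open>
  Let \<open>\<gamma>\<close> act on the right cosets of \<open>K\<close> by right multiplication. The cycle of \<open>K t\<close> has length
  \<open>return_exp G K \<gamma> t\<close>. In terms of orbits, \<open>stab_gen G K \<gamma> t\<close> generates \<open>K \<inter> t \<langle>\<gamma>\<rangle> t\<^sup>-\<^sup>1\<close>, the
  stabilizer in \<open>K\<close>.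
\<close>
definition return_exp :: "('a, 'm) monoid_scheme \<Rightarrow> 'a set \<Rightarrow> 'a \<Rightarrow> 'a \<Rightarrow> nat" where
  "return_exp G K \<gamma> t = (LEAST m. 1 \<le> m \<and> conj_by G t (\<gamma> [^]\<^bsub>G\<^esub> m) \<in> K)"

definition stab_gen :: "('a, 'm) monoid_scheme \<Rightarrow> 'a set \<Rightarrow> 'a \<Rightarrow> 'a \<Rightarrow> 'a" where
  "stab_gen G K \<gamma> t = conj_by G t (\<gamma> [^]\<^bsub>G\<^esub> return_exp G K \<gamma> t)"

lemma res_entry_eq: "res_entry G K \<gamma> t = conj_class (G\<lparr>carrier := K\<rparr>) (stab_gen G K \<gamma> t)"
  by (simp add: res_entry_def stab_gen_def return_exp_def)

definition orbit_reps :: "('a, 'm) monoid_scheme \<Rightarrow> 'a set \<Rightarrow> 'a \<Rightarrow> 'a list" where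
  "orbit_reps G K \<gamma> = (SOME ts. distinct ts \<and> dcoset_transversal G K (generate G {\<gamma>}) (set ts))"

definition res_tuple :: "('a, 'm) monoid_scheme \<Rightarrow> 'a set \<Rightarrow> 'a \<Rightarrow> 'a list" where
  "res_tuple G K \<gamma> = map (stab_gen G K \<gamma>) (orbit_reps G K \<gamma>)"

locale finite_restriction = group G for G :: "('a, 'm) monoid_scheme" (structure) +
  fixes K :: "'a set"
  assumes fin: "finite (carrier G)" and K: "subgroup K G"
begin

abbreviation GK where "GK \<equiv> G\<lparr>carrier := K\<rparr>"

sublocale GK: group GK
  by (rule subgroup.subgroup_is_group[OF K is_group])

lemma K_carrier: "x \<in> K \<Longrightarrow> x \<in> carrier G"
  using K by (rule subgroup.mem_carrier)

lemma conj_by_GK [simp]: "k \<in> K \<Longrightarrow> conj_by GK k x = conj_by G k x"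
  using K by (simp add: conj_by_def)

lemma conj_by_K_iff:
  assumes "k \<in> K" "x \<in> carrier G"
  shows "conj_by G k x \<in> K \<longleftrightarrow> x \<in> K"
proof
  have closed: "conj_by G h y \<in> K" if "h \<in> K" "y \<in> K" for h y
    using that K by (simp add: conj_by_def subgroup.m_closed subgroup.m_inv_closed)
  then show "x \<in> K \<Longrightarrow> conj_by G k x \<in> K" using assms by simp
  assume "conj_by G k x \<in> K"
  then have "conj_by G (inv k) (conj_by G k x) \<in> K"
    using closed subgroup.m_inv_closed[OF K assms(1)] by blast
  then show "x \<in> K" using conj_by_inv_cancel(1)[OF K_carrier[OF assms(1)] assms(2)] by simp
qed

lemma subgroup_generate: "\<gamma> \<in> carrier G \<Longrightarrow> subgroup (generate G {\<gamma>}) G"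
  by (simp add: generate_is_subgroup)

lemma mem_generate_pow:
  "\<gamma> \<in> carrier G \<Longrightarrow> z \<in> generate G {\<gamma>} \<Longrightarrow> \<exists>n::nat. z = \<gamma> [^] n"
  using generate_pow_on_finite_carrier[OF fin] by auto

lemma orbit_reps:
  assumes "\<gamma> \<in> carrier G"
  shows "distinct (orbit_reps G K \<gamma>)"
    and "dcoset_transversal G K (generate G {\<gamma>}) (set (orbit_reps G K \<gamma>))"
proof -
  obtain T where T: "dcoset_transversal G K (generate G {\<gamma>}) T"
    using dcoset_transversal_exists[OF K subgroup_generate[OF assms]] by blast
  then have "finite T" using finite_subset[OF _ fin] by (auto simp: dcoset_transversal_def)
  then obtain ts where "distinct ts" "set ts = T" using finite_distinct_list by blast
  with T have "\<exists>ts. distinct ts \<and> dcoset_transversal G K (generate G {\<gamma>}) (set ts)" by blast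
  then have "distinct (orbit_reps G K \<gamma>) \<and>
      dcoset_transversal G K (generate G {\<gamma>}) (set (orbit_reps G K \<gamma>))"
    unfolding orbit_reps_def by (rule someI_ex)
  then show "distinct (orbit_reps G K \<gamma>)"
    and "dcoset_transversal G K (generate G {\<gamma>}) (set (orbit_reps G K \<gamma>))" by auto
qed

lemma return_exp_props:
  assumes "\<gamma> \<in> carrier G" "t \<in> carrier G"
  shows "1 \<le> return_exp G K \<gamma> t \<and> stab_gen G K \<gamma> t \<in> K"
  unfolding stab_gen_def return_exp_def
proof (rule LeastI)
  show "1 \<le> order G \<and> conj_by G t (\<gamma> [^] order G) \<in> K"
    using assms fin K subgroup.one_closed[OF K]
    by (simp add: pow_order_eq_1 order_gt_0_iff_finite Suc_le_eq)
qed

lemma return_exp_le: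
  "1 \<le> m \<Longrightarrow> conj_by G t (\<gamma> [^] m) \<in> K \<Longrightarrow> return_exp G K \<gamma> t \<le> m"
  unfolding return_exp_def by (rule Least_le) simp

text \<open>
  For \<open>g = k t z\<close> with \<open>z\<close> a power of \<open>\<gamma>\<close>, conjugating a power of \<open>\<gamma>\<close> by \<open>g\<close> is the same as conjugating
  it by \<open>t\<close> and then by \<open>k \<in> K\<close>.
\<close>
lemma res_entry_dcoset:
  assumes \<gamma>: "\<gamma> \<in> carrier G" and t: "t \<in> carrier G" and g: "g \<in> dcoset G K t (generate G {\<gamma>})"
  shows "res_entry G K \<gamma> g = res_entry G K \<gamma> t"
proof -
  obtain k z where kz: "k \<in> K" "z \<in> generate G {\<gamma>}" "g = k \<otimes> t \<otimes> z"
    using g by (auto simp: mem_dcoset)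
  obtain n :: nat where z: "z = \<gamma> [^] n" using mem_generate_pow[OF \<gamma> kz(2)] by blast
  have conj: "conj_by G g (\<gamma> [^] m) = conj_by G k (conj_by G t (\<gamma> [^] m))" for m :: nat
    using kz(1) \<gamma> t K_carrier by (simp add: kz(3) z conj_by_mult_left conj_by_pow_commute)
  then have "return_exp G K \<gamma> g = return_exp G K \<gamma> t"
    using conj_by_K_iff[OF kz(1)] \<gamma> t by (simp add: return_exp_def)
  then have "stab_gen G K \<gamma> g = conj_by GK k (stab_gen G K \<gamma> t)"
    using conj kz(1) by (simp add: stab_gen_def)
  then show ?thesis
    using GK.conj_class_conj_by[of k "stab_gen G K \<gamma> t"] return_exp_props[OF \<gamma> t] kz(1)
    by (simp add: res_entry_eq)
qed

text \<open>
  Every choice of representatives computes the restriction. All properties of \<open>res_tuple\<close> up to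
  conjugacy follow from this by picking a convenient transversal.
\<close>
lemma res_classes_transversal:
  assumes \<gamma>: "\<gamma> \<in> carrier G" and T: "dcoset_transversal G K (generate G {\<gamma>}) T"
  shows "reduce_classes GK (res_classes G K \<gamma>) = (\<Sum>t\<in>T. class_tuple GK [stab_gen G K \<gamma> t])"
proof -
  let ?dc = "\<lambda>t. dcoset G K t (generate G {\<gamma>})"
  note Z = subgroup_generate[OF \<gamma>]
  have "res_entry G K \<gamma> (SOME x. x \<in> ?dc t) = res_entry G K \<gamma> t" if "t \<in> T" for t
  proof -
    have t: "t \<in> carrier G" using dcoset_transversalD(1)[OF T] that by auto
    have "(SOME x. x \<in> ?dc t) \<in> ?dc t" using dcoset_self[OF K Z t] by (rule someI)
    then show ?thesis by (rule res_entry_dcoset[OF \<gamma> t])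
  qed
  moreover have "finite T"
    using dcoset_transversalD(1)[OF T] finite_subset[OF _ fin] by blast
  ultimately have "res_classes G K \<gamma> = image_mset (res_entry G K \<gamma>) (mset_set T)"
    unfolding res_classes_def dcoset_transversal_image[OF K Z T, symmetric]
      image_mset_mset_set[OF dcoset_transversal_inj_on[OF K Z T], symmetric]
    by (auto simp: image_mset.compositionality intro!: image_mset_cong)
  moreover have "reduce_classes GK (image_mset (res_entry G K \<gamma>) (mset_set T))
      = (\<Sum>t\<in>T. class_tuple GK [stab_gen G K \<gamma> t])"
    using \<open>finite T\<close>
    by (induction T) (auto simp: reduce_classes_def class_tuple_def res_entry_eq)
  ultimately show ?thesis by simp
qed

lemma class_tuple_res_tuple:
  "\<gamma> \<in> carrier G \<Longrightarrow> class_tuple GK (res_tuple G K \<gamma>) = reduce_classes GK (res_classes G K \<gamma>)"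
  using orbit_reps[of \<gamma>]
  by (simp add: res_tuple_def class_tuple_map_distinct res_classes_transversal)

lemma set_res_tuple: "\<gamma> \<in> carrier G \<Longrightarrow> set (res_tuple G K \<gamma>) \<subseteq> K"
  using orbit_reps(2)[of \<gamma>] return_exp_props by (auto simp: res_tuple_def dcoset_transversal_def)

lemma class_tuple_res_tuple_transversal:
  "\<gamma> \<in> carrier G \<Longrightarrow> dcoset_transversal G K (generate G {\<gamma>}) T \<Longrightarrow>
   class_tuple GK (res_tuple G K \<gamma>) = (\<Sum>t\<in>T. class_tuple GK [stab_gen G K \<gamma> t])"
  by (simp add: class_tuple_res_tuple res_classes_transversal)

lemma stab_gen_conj:
  assumes "\<gamma> \<in> carrier G" "g \<in> carrier G" "t \<in> carrier G"
  shows "stab_gen G K (conj_by G g \<gamma>) (t \<otimes> inv g) = stab_gen G K \<gamma> t"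
proof -
  have "conj_by G (t \<otimes> inv g) (conj_by G g \<gamma> [^] m) = conj_by G t (\<gamma> [^] m)" for m :: nat
    using assms by (simp add: conj_by_mult_left flip: conj_by_pow)
  then show ?thesis by (simp add: stab_gen_def return_exp_def)
qed

lemma stab_gen_inv:
  assumes "\<gamma> \<in> carrier G" "t \<in> carrier G"
  shows "stab_gen G K (inv \<gamma>) t = inv (stab_gen G K \<gamma> t)"
proof -
  have eq: "conj_by G t (inv \<gamma> [^] m) = inv (conj_by G t (\<gamma> [^] m))" for m :: nat
    using assms by (simp add: nat_pow_inv conj_by_inv)
  have "inv x \<in> K \<longleftrightarrow> x \<in> K" if "x \<in> carrier G" for x
    using subgroup.m_inv_closed[OF K, of x] subgroup.m_inv_closed[OF K, of "inv x"] that by auto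
  then have "return_exp G K (inv \<gamma>) t = return_exp G K \<gamma> t"
    using assms by (simp add: return_exp_def eq)
  then show ?thesis by (simp add: stab_gen_def eq)
qed

lemma generate_inv:
  assumes "\<gamma> \<in> carrier G"
  shows "generate G {inv \<gamma>} = generate G {\<gamma>}"
proof -
  have "generate G {inv x} \<subseteq> generate G {x}" if "x \<in> carrier G" for x
    using that generate_subgroup_incl[OF _ subgroup_generate[OF that], of "{inv x}"]
    by (auto intro: generate.inv)
  from this[of \<gamma>] this[of "inv \<gamma>"] assms show ?thesis by auto
qed

text \<open>
  The representatives \<open>t g\<^sup>-\<^sup>1\<close> for \<open>g \<gamma> g\<^sup>-\<^sup>1\<close> yield literally the same elements as the \<open>t\<close> for \<open>\<gamma>\<close>.
\<close>
lemma class_tuple_res_tuple_conj: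
  assumes "\<gamma> \<in> carrier G" "g \<in> carrier G"
  shows "class_tuple GK (res_tuple G K (conj_by G g \<gamma>)) = class_tuple GK (res_tuple G K \<gamma>)"
proof -
  obtain T where T: "dcoset_transversal G K (generate G {\<gamma>}) T"
    using orbit_reps(2)[OF assms(1)] by blast
  note Tc = dcoset_transversalD(1)[OF T]
  have "dcoset_transversal G K (generate G {conj_by G g \<gamma>}) ((\<lambda>t. t \<otimes> inv g) ` T)"
    using dcoset_transversal_translate[OF _ _ T assms(2)] assms K subgroup_generate[OF assms(1)]
    by (simp add: conj_by_generate subgroup.subset)
  moreover have "inj_on (\<lambda>t. t \<otimes> inv g) T" using Tc assms(2) by (auto intro!: inj_onI)
  ultimately show ?thesis
    using T Tc assms
    by (simp add: class_tuple_res_tuple_transversal sum.reindex stab_gen_conj cong: sum.cong)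
qed

lemma class_tuple_res_tuple_one: "class_tuple GK (res_tuple G K \<one>) = {#}"
proof -
  obtain T where T: "dcoset_transversal G K (generate G {\<one>}) T"
    using orbit_reps(2)[OF one_closed] by blast
  have "class_tuple GK [stab_gen G K \<one> t] = {#}" if "t \<in> T" for t
    using class_tuple_one[of GK] dcoset_transversalD(1)[OF T that] by (simp add: stab_gen_def)
  then show ?thesis by (simp add: class_tuple_res_tuple_transversal[OF one_closed T])
qed

text \<open>
  Since \<open>\<gamma>\<close> and \<open>\<gamma>\<^sup>-\<^sup>1\<close> generate the same subgroup, one transversal serves both, and its elements
  contribute pairs of mutually inverse classes.
\<close>
lemma class_tuple_res_tuple_inv:
  assumes "\<gamma> \<in> carrier G"
  shows "class_tuple GK (res_tuple G K \<gamma>) + class_tuple GK (res_tuple G K (inv \<gamma>))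
    \<in> submonoid_gen (Lam GK) (inv_pairs GK)"
proof -
  obtain T where T: "dcoset_transversal G K (generate G {\<gamma>}) T"
    using orbit_reps(2)[OF assms(1)] by blast
  note Tc = dcoset_transversalD(1)[OF T]
  note N = GK.submonoid_inv_pairs
  have pair: "class_tuple GK [stab_gen G K \<gamma> t] + class_tuple GK [stab_gen G K (inv \<gamma>) t]
      \<in> submonoid_gen (Lam GK) (inv_pairs GK)" if "t \<in> T" for t
    using GK.class_tuple_pair_mem[of "stab_gen G K \<gamma> t"] return_exp_props[OF assms Tc[OF that]] K
    by (simp add: stab_gen_inv[OF assms Tc[OF that]])
  have sum_mem: "sum f U \<in> submonoid_gen (Lam GK) (inv_pairs GK)"
    if "finite U" "\<And>t. t \<in> U \<Longrightarrow> f t \<in> submonoid_gen (Lam GK) (inv_pairs GK)"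
    for U and f :: "'a \<Rightarrow> 'a set multiset"
    using that submonoid.one_closed[OF N] submonoid.m_closed[OF N]
    by (induction U) auto
  have "finite T" using Tc finite_subset[OF _ fin] by blast
  then have "(\<Sum>t\<in>T. class_tuple GK [stab_gen G K \<gamma> t] + class_tuple GK [stab_gen G K (inv \<gamma>) t])
      \<in> submonoid_gen (Lam GK) (inv_pairs GK)"
    using pair by (intro sum_mem)
  then show ?thesis
    using T assms
    by (simp add: class_tuple_res_tuple_transversal[of _ T] generate_inv sum.distrib)
qed

end

section \<open>The transfer homomorphism\<close>

lemma (in group) coset_eq_diff:
  assumes "subgroup K G" "x \<in> carrier G" "y \<in> carrier G" "K #> x = K #> y"
  shows "x \<otimes> inv y \<in> K"
proof -
  have "x \<in> K #> y" using rcos_self[OF assms(2,1)] assms(4) by simp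
  then obtain k where "k \<in> K" "x = k \<otimes> y" by (auto simp: r_coset_def)
  then show ?thesis using assms by (simp add: m_assoc subgroup.mem_carrier)
qed

lemma (in group) coset_eqI:
  assumes "subgroup K G" "x \<in> carrier G" "y \<in> carrier G" "x \<otimes> inv y \<in> K"
  shows "K #> x = K #> y"
proof -
  have "x = (x \<otimes> inv y) \<otimes> y" using assms by (simp add: m_assoc)
  then have "x \<in> K #> y" using assms(4) by (auto simp: r_coset_def)
  then show ?thesis using repr_independence[OF _ assms(3,1)] by simp
qed

lemma (in group_hom) hom_conj_by:
  assumes "comm_group H" "g \<in> carrier G" "x \<in> carrier G"
  shows "h (conj_by G g x) = h x"
proof -
  interpret H: comm_group H by fact
  have "h (conj_by G g x) = h g \<otimes>\<^bsub>H\<^esub> h x \<otimes>\<^bsub>H\<^esub> inv\<^bsub>H\<^esub> h g"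
    using assms by (simp add: conj_by_def)
  also have "\<dots> = h x \<otimes>\<^bsub>H\<^esub> h g \<otimes>\<^bsub>H\<^esub> inv\<^bsub>H\<^esub> h g"
    using assms by (simp add: H.m_comm)
  finally show ?thesis using assms by (simp add: H.m_assoc)
qed

context finite_restriction
begin

definition coset_rep :: "'a set \<Rightarrow> 'a" where
  "coset_rep C = (SOME x. x \<in> C)"

lemma coset_rep:
  assumes "x \<in> carrier G"
  shows "coset_rep (K #> x) \<in> carrier G" "K #> coset_rep (K #> x) = K #> x"
proof -
  have "coset_rep (K #> x) \<in> K #> x"
    unfolding coset_rep_def using rcos_self[OF assms K] by (rule someI)
  then show "coset_rep (K #> x) \<in> carrier G" "K #> coset_rep (K #> x) = K #> x"
    using r_coset_subset_G[OF subgroup.subset[OF K] assms] repr_independence[OF _ assms K] by auto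
qed

lemma coset_translate: "x \<in> carrier G \<Longrightarrow> g \<in> carrier G \<Longrightarrow> (K #> x) #> g = K #> (x \<otimes> g)"
  using coset_mult_assoc[OF subgroup.subset[OF K]] by simp

lemma rcosets_cases:
  assumes "C \<in> rcosets K"
  obtains x where "x \<in> carrier G" "C = K #> x"
  using assms by (auto simp: RCOSETS_def)

text \<open>
  With fixed representatives \<open>r C\<close> of the right cosets \<open>C\<close> of \<open>K\<close>, the element \<open>r C \<cdot> g\<close> lies in the
  coset \<open>C g\<close>, and \<open>cocycle g C \<in> K\<close> is the factor by which it differs from \<open>r (C g)\<close>.
\<close>
definition cocycle :: "'a \<Rightarrow> 'a set \<Rightarrow> 'a" where
  "cocycle g C = coset_rep C \<otimes> g \<otimes> inv (coset_rep (C #> g))"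

lemma cocycle_mem:
  assumes "C \<in> rcosets K" "g \<in> carrier G"
  shows "cocycle g C \<in> K"
proof -
  obtain x where x: "x \<in> carrier G" "C = K #> x" using assms(1) by (rule rcosets_cases)
  have "K #> (coset_rep C \<otimes> g) = (K #> coset_rep C) #> g"
    using coset_rep(1)[OF x(1)] x(2) assms(2) by (simp add: coset_translate)
  also have "\<dots> = C #> g" using coset_rep(2)[OF x(1)] x(2) by simp
  also have "\<dots> = K #> coset_rep (C #> g)"
    using coset_rep(2)[of "x \<otimes> g"] x assms(2) by (simp add: coset_translate)
  finally show ?thesis
    unfolding cocycle_def using coset_rep[OF x(1)] coset_rep[of "x \<otimes> g"] x assms
    by (intro coset_eq_diff[OF K]) (simp_all add: coset_translate)
qed

lemma cocycle_mult:
  assumes "C \<in> rcosets K" "g \<in> carrier G" "h \<in> carrier G"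
  shows "cocycle (g \<otimes> h) C = cocycle g C \<otimes> cocycle h (C #> g)"
proof -
  obtain x where x: "x \<in> carrier G" "C = K #> x" using assms(1) by (rule rcosets_cases)
  have "coset_rep C \<in> carrier G" "coset_rep (C #> g) \<in> carrier G"
      "coset_rep (C #> (g \<otimes> h)) \<in> carrier G"
    using coset_rep(1) x assms by (auto simp: coset_translate)
  moreover have "C #> g #> h = C #> (g \<otimes> h)"
    using x assms by (simp add: coset_translate m_assoc)
  ultimately show ?thesis
    using assms by (simp add: cocycle_def m_assoc inv_solve_left' flip: m_assoc[of "inv _"])
qed

lemma bij_betw_translate:
  assumes g: "g \<in> carrier G"
  shows "bij_betw (\<lambda>C. C #> g) (rcosets K) (rcosets K)"
proof (rule bij_betw_byWitness[where f' = "\<lambda>C. C #> inv g"])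
  show "\<forall>C\<in>rcosets K. (C #> g) #> inv g = C" "\<forall>C\<in>rcosets K. (C #> inv g) #> g = C"
    using g by (auto simp: RCOSETS_def coset_translate m_assoc)
  show "(\<lambda>C. C #> g) ` (rcosets K) \<subseteq> rcosets K" "(\<lambda>C. C #> inv g) ` (rcosets K) \<subseteq> rcosets K"
    using g by (auto simp: coset_translate elim!: rcosets_cases
        intro!: rcosetsI[OF subgroup.subset[OF K]])
qed

text \<open>
  The classical transfer (Verlagerung) is the case where \<open>\<phi>\<close> is the projection of \<open>K\<close> to its
  abelianization \<open>A\<close>.
\<close>
definition transfer :: "('b, 'n) monoid_scheme \<Rightarrow> ('a \<Rightarrow> 'b) \<Rightarrow> 'a \<Rightarrow> 'b" where
  "transfer A \<phi> g = (\<Otimes>\<^bsub>A\<^esub>C\<in>rcosets K. \<phi> (cocycle g C))"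

text \<open>
  The cocycle identity splits the product for \<open>g h\<close> into the product for \<open>g\<close> and one for \<open>h\<close> whose index
  is shifted by the permutation \<open>C \<mapsto> C g\<close> of the cosets.
\<close>
lemma transfer_hom:
  assumes A: "comm_group A" and \<phi>: "\<phi> \<in> hom GK A"
  shows "transfer A \<phi> \<in> hom G A"
proof -
  interpret A: comm_group A by (rule A)
  have closed: "\<phi> k \<in> carrier A" if "k \<in> K" for k using hom_in_carrier[OF \<phi>] that by simp
  have mult: "\<phi> (k \<otimes> l) = \<phi> k \<otimes>\<^bsub>A\<^esub> \<phi> l" if "k \<in> K" "l \<in> K" for k l
    using hom_mult[OF \<phi>] that by simp
  show ?thesis
  proof (rule homI)
    fix g assume "g \<in> carrier G"
    then show "transfer A \<phi> g \<in> carrier A"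
      unfolding transfer_def by (auto intro!: A.finprod_closed closed cocycle_mem)
  next
    fix g h assume g: "g \<in> carrier G" and h: "h \<in> carrier G"
    note bij = bij_betw_translate[OF g]
    have mem: "C #> g \<in> rcosets K" if "C \<in> rcosets K" for C
      using bij_betwE[OF bij] that by auto
    have "transfer A \<phi> (g \<otimes> h)
        = (\<Otimes>\<^bsub>A\<^esub>C\<in>rcosets K. \<phi> (cocycle g C) \<otimes>\<^bsub>A\<^esub> \<phi> (cocycle h (C #> g)))"
      unfolding transfer_def using g h mem
      by (intro A.finprod_cong') (auto simp: cocycle_mult mult cocycle_mem intro!: closed cocycle_mem)
    also have "\<dots> = transfer A \<phi> g \<otimes>\<^bsub>A\<^esub> (\<Otimes>\<^bsub>A\<^esub>C\<in>rcosets K. \<phi> (cocycle h (C #> g)))"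
      unfolding transfer_def using g h mem
      by (intro A.finprod_multf) (auto intro!: closed cocycle_mem)
    also have "(\<Otimes>\<^bsub>A\<^esub>C\<in>rcosets K. \<phi> (cocycle h (C #> g)))
        = (\<Otimes>\<^bsub>A\<^esub>C\<in>(\<lambda>C. C #> g) ` (rcosets K). \<phi> (cocycle h C))"
      using bij h by (intro A.finprod_reindex[symmetric])
        (auto simp: bij_betw_def intro!: closed cocycle_mem)
    also have "\<dots> = transfer A \<phi> h"
      using bij by (simp add: bij_betw_def transfer_def)
    finally show "transfer A \<phi> (g \<otimes> h) = transfer A \<phi> g \<otimes>\<^bsub>A\<^esub> transfer A \<phi> h" .
  qed
qed

definition orbit_coset :: "'a \<Rightarrow> 'a \<Rightarrow> nat \<Rightarrow> 'a set" where
  "orbit_coset \<gamma> t n = K #> (t \<otimes> \<gamma> [^] n)"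

lemma orbit_coset_Suc:
  "\<gamma> \<in> carrier G \<Longrightarrow> t \<in> carrier G \<Longrightarrow> orbit_coset \<gamma> t n #> \<gamma> = orbit_coset \<gamma> t (Suc n)"
  by (simp add: orbit_coset_def coset_translate m_assoc)

lemma orbit_coset_mem: "\<gamma> \<in> carrier G \<Longrightarrow> t \<in> carrier G \<Longrightarrow> orbit_coset \<gamma> t n \<in> rcosets K"
  by (auto simp: orbit_coset_def RCOSETS_def)

text \<open>
  Whether the cycle closes after \<open>m\<close> steps does not depend on the starting point; this is why the
  cycle of \<open>K t\<close> has length \<open>return_exp G K \<gamma> t\<close>.
\<close>
lemma orbit_coset_eq_iff:
  assumes "\<gamma> \<in> carrier G" "t \<in> carrier G"
  shows "orbit_coset \<gamma> t (n + m) = orbit_coset \<gamma> t n \<longleftrightarrow> conj_by G t (\<gamma> [^] m) \<in> K"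
proof -
  have "(t \<otimes> \<gamma> [^] (n + m)) \<otimes> inv (t \<otimes> \<gamma> [^] n) = conj_by G t (\<gamma> [^] m)"
  proof -
    have "(t \<otimes> \<gamma> [^] (n + m)) \<otimes> inv (t \<otimes> \<gamma> [^] n)
        = t \<otimes> \<gamma> [^] m \<otimes> (\<gamma> [^] n \<otimes> inv (\<gamma> [^] n)) \<otimes> inv t"
      using assms
      by (simp only: add.commute[of n m] nat_pow_mult[symmetric] inv_mult_group m_assoc
          m_closed nat_pow_closed inv_closed)
    then show ?thesis using assms by (simp add: conj_by_def)
  qed
  moreover have "t \<otimes> \<gamma> [^] (n + m) \<in> carrier G" "t \<otimes> \<gamma> [^] n \<in> carrier G" using assms by auto
  ultimately show ?thesis
    unfolding orbit_coset_def using coset_eq_diff[OF K] coset_eqI[OF K] by metis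
qed

lemma orbit_coset_period:
  assumes "\<gamma> \<in> carrier G" "t \<in> carrier G"
  shows "\<exists>i<return_exp G K \<gamma> t. orbit_coset \<gamma> t n = orbit_coset \<gamma> t i"
proof (induction n rule: less_induct)
  case (less n)
  let ?m = "return_exp G K \<gamma> t"
  show ?case
  proof (cases "n < ?m")
    case False
    have "1 \<le> ?m" "conj_by G t (\<gamma> [^] ?m) \<in> K"
      using return_exp_props[OF assms] by (auto simp: stab_gen_def)
    then show ?thesis
      using less[of "n - ?m"] False orbit_coset_eq_iff[OF assms, of "n - ?m" ?m] by auto
  qed auto
qed

lemma orbit_coset_inj:
  assumes \<gamma>: "\<gamma> \<in> carrier G" and t: "t \<in> carrier G"
    and ij: "i < return_exp G K \<gamma> t" "j < return_exp G K \<gamma> t"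
    and eq: "orbit_coset \<gamma> t i = orbit_coset \<gamma> t j"
  shows "i = j"
proof -
  have "i = j" if "i \<le> j" "j < return_exp G K \<gamma> t" "orbit_coset \<gamma> t j = orbit_coset \<gamma> t i" for i j
  proof (rule ccontr)
    assume "i \<noteq> j"
    then have "return_exp G K \<gamma> t \<le> j - i"
      using that orbit_coset_eq_iff[OF \<gamma> t, of i "j - i"] by (intro return_exp_le) auto
    then show False using that return_exp_props[OF \<gamma> t] by linarith
  qed
  then show ?thesis using ij eq by (cases i j rule: le_cases) auto
qed

text \<open>
  The double coset \<open>K t \<langle>\<gamma>\<rangle>\<close> is the union of the cosets in the cycle of \<open>K t\<close> under \<open>\<gamma>\<close>, so a
  transversal of the double cosets meets each cycle exactly once.
\<close>
lemma rcosets_eq_UN_orbits: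
  assumes \<gamma>: "\<gamma> \<in> carrier G" and T: "dcoset_transversal G K (generate G {\<gamma>}) T"
  shows "rcosets K = (\<Union>t\<in>T. orbit_coset \<gamma> t ` {..<return_exp G K \<gamma> t})"
proof
  show "(\<Union>t\<in>T. orbit_coset \<gamma> t ` {..<return_exp G K \<gamma> t}) \<subseteq> rcosets K"
    using orbit_coset_mem[OF \<gamma>] dcoset_transversalD(1)[OF T] by auto
  show "rcosets K \<subseteq> (\<Union>t\<in>T. orbit_coset \<gamma> t ` {..<return_exp G K \<gamma> t})"
  proof
    fix C assume "C \<in> rcosets K"
    then obtain x where x: "x \<in> carrier G" "C = K #> x" by (rule rcosets_cases)
    obtain t k z where t: "t \<in> T" "k \<in> K" "z \<in> generate G {\<gamma>}" "x = k \<otimes> t \<otimes> z"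
      using dcoset_transversalD(2)[OF T x(1)] by (auto simp: mem_dcoset)
    obtain n :: nat where z: "z = \<gamma> [^] n" using mem_generate_pow[OF \<gamma> t(3)] by blast
    note tc = dcoset_transversalD(1)[OF T t(1)]
    have "x = k \<otimes> (t \<otimes> \<gamma> [^] n)" using t z tc \<gamma> K_carrier by (simp add: m_assoc)
    then have "C = orbit_coset \<gamma> t n"
      using x tc \<gamma> t(2) repr_independence[OF _ _ K, of x "t \<otimes> \<gamma> [^] n"]
      by (auto simp: orbit_coset_def r_coset_def)
    then show "C \<in> (\<Union>t\<in>T. orbit_coset \<gamma> t ` {..<return_exp G K \<gamma> t})"
      using orbit_coset_period[OF \<gamma> tc, of n] t(1) by auto
  qed
qed

lemma orbits_disjoint:
  assumes \<gamma>: "\<gamma> \<in> carrier G" and T: "dcoset_transversal G K (generate G {\<gamma>}) T"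
    and t: "t \<in> T" "t' \<in> T" and eq: "orbit_coset \<gamma> t i = orbit_coset \<gamma> t' j"
  shows "t = t'"
proof -
  note tc = dcoset_transversalD(1)[OF T t(1)] dcoset_transversalD(1)[OF T t(2)]
  let ?x = "t \<otimes> \<gamma> [^] i"
  have pow: "\<gamma> [^] n \<in> generate G {\<gamma>}" for n :: nat
    using generate_pow_on_finite_carrier[OF fin \<gamma>] by auto
  have x: "?x \<in> carrier G" using tc \<gamma> by simp
  have "?x \<in> K #> (t' \<otimes> \<gamma> [^] j)"
    using rcos_self[OF x K] eq by (simp add: orbit_coset_def)
  then obtain k where "k \<in> K" "?x = k \<otimes> (t' \<otimes> \<gamma> [^] j)" by (auto simp: r_coset_def)
  then have "?x \<in> dcoset G K t' (generate G {\<gamma>})"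
    using tc \<gamma> pow K_carrier by (intro dcosetI[of k _ "\<gamma> [^] j"]) (auto simp: m_assoc)
  moreover have "?x \<in> dcoset G K t (generate G {\<gamma>})"
    using tc \<gamma> pow subgroup.one_closed[OF K] by (intro dcosetI[of \<one> _ "\<gamma> [^] i"]) auto
  ultimately show ?thesis using dcoset_transversalD(3)[OF T t x] by simp
qed

text \<open>
  Along the cycle of \<open>K t\<close> the cocycle values are \<open>r\<^sub>i \<gamma> r\<^sub>i\<^sub>+\<^sub>1\<^sup>-\<^sup>1\<close>, so that consecutive representatives
  cancel. The membership in \<open>K\<close> is proved along with the formula because \<open>\<phi>\<close> is multiplicative only
  on \<open>K\<close>.
\<close>
lemma prod_cocycle_orbit:
  assumes A: "comm_group A" and \<phi>: "\<phi> \<in> hom GK A"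
    and \<gamma>: "\<gamma> \<in> carrier G" and t: "t \<in> carrier G"
  defines "r \<equiv> \<lambda>n. coset_rep (orbit_coset \<gamma> t n)"
  shows "r 0 \<otimes> \<gamma> [^] n \<otimes> inv (r n) \<in> K \<and>
    (\<Otimes>\<^bsub>A\<^esub>i\<in>{..<n}. \<phi> (cocycle \<gamma> (orbit_coset \<gamma> t i))) = \<phi> (r 0 \<otimes> \<gamma> [^] n \<otimes> inv (r n))"
proof -
  interpret A: comm_group A by (rule A)
  have r: "r i \<in> carrier G" for i
    using coset_rep(1) \<gamma> t by (simp add: r_def orbit_coset_def)
  interpret \<phi>: group_hom GK A \<phi>
    using \<phi> by unfold_locales
  have c: "cocycle \<gamma> (orbit_coset \<gamma> t i) = r i \<otimes> \<gamma> \<otimes> inv (r (Suc i))" for i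
    using \<gamma> t by (simp add: cocycle_def r_def orbit_coset_Suc)
  have cK: "r i \<otimes> \<gamma> \<otimes> inv (r (Suc i)) \<in> K" for i
    using cocycle_mem[OF orbit_coset_mem[OF \<gamma> t] \<gamma>, of i] by (simp only: c)
  show ?thesis
  proof (induction n)
    case 0
    then show ?case using r \<phi>.hom_one subgroup.one_closed[OF K] by simp
  next
    case (Suc n)
    have split: "r 0 \<otimes> \<gamma> [^] Suc n \<otimes> inv (r (Suc n))
        = (r 0 \<otimes> \<gamma> [^] n \<otimes> inv (r n)) \<otimes> (r n \<otimes> \<gamma> \<otimes> inv (r (Suc n)))"
    proof -
      have "(r 0 \<otimes> \<gamma> [^] n \<otimes> inv (r n)) \<otimes> (r n \<otimes> \<gamma> \<otimes> inv (r (Suc n)))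
          = r 0 \<otimes> \<gamma> [^] n \<otimes> (inv (r n) \<otimes> r n) \<otimes> \<gamma> \<otimes> inv (r (Suc n))"
        using r \<gamma> by (simp only: m_assoc m_closed nat_pow_closed inv_closed)
      then show ?thesis using r \<gamma> by (simp add: m_assoc)
    qed
    have "(\<Otimes>\<^bsub>A\<^esub>i\<in>{..<Suc n}. \<phi> (cocycle \<gamma> (orbit_coset \<gamma> t i)))
        = \<phi> (r n \<otimes> \<gamma> \<otimes> inv (r (Suc n))) \<otimes>\<^bsub>A\<^esub> (\<Otimes>\<^bsub>A\<^esub>i\<in>{..<n}. \<phi> (cocycle \<gamma> (orbit_coset \<gamma> t i)))"
      using \<phi>.hom_closed cK by (simp add: lessThan_Suc c Pi_def)
    also have "\<dots> = \<phi> (r n \<otimes> \<gamma> \<otimes> inv (r (Suc n))) \<otimes>\<^bsub>A\<^esub> \<phi> (r 0 \<otimes> \<gamma> [^] n \<otimes> inv (r n))"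
      using Suc by simp
    also have "\<dots> = \<phi> (r 0 \<otimes> \<gamma> [^] Suc n \<otimes> inv (r (Suc n)))"
      unfolding split using Suc cK[of n] \<phi>.hom_mult[of "r 0 \<otimes> \<gamma> [^] n \<otimes> inv (r n)"] \<phi>.hom_closed
      by (simp add: A.m_comm)
    finally show ?case
      using split Suc cK[of n] subgroup.m_closed[OF K] by simp
  qed
qed

text \<open>
  Taken over a whole cycle the telescoping product is \<open>r \<gamma>\<^sup>m r\<^sup>-\<^sup>1\<close> with \<open>r\<close> the chosen representative of
  \<open>K t\<close>. It is conjugate in \<open>K\<close> to \<open>t \<gamma>\<^sup>m t\<^sup>-\<^sup>1\<close>, which \<open>\<phi>\<close> cannot distinguish from it since its values
  commute.
\<close>
lemma transfer_eval:
  assumes A: "comm_group A" and \<phi>: "\<phi> \<in> hom GK A"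
    and \<gamma>: "\<gamma> \<in> carrier G" and T: "dcoset_transversal G K (generate G {\<gamma>}) T"
  shows "transfer A \<phi> \<gamma> = (\<Otimes>\<^bsub>A\<^esub>t\<in>T. \<phi> (stab_gen G K \<gamma> t))"
proof -
  interpret A: comm_group A by (rule A)
  interpret \<phi>: group_hom GK A \<phi>
    using \<phi> by unfold_locales
  note tc = dcoset_transversalD(1)[OF T]
  have closed: "\<phi> (cocycle \<gamma> C) \<in> carrier A" if "C \<in> rcosets K" for C
    using \<phi>.hom_closed cocycle_mem[OF that \<gamma>] by simp
  have orbit: "(\<Otimes>\<^bsub>A\<^esub>C\<in>orbit_coset \<gamma> t ` {..<return_exp G K \<gamma> t}. \<phi> (cocycle \<gamma> C))
      = \<phi> (stab_gen G K \<gamma> t)" if t: "t \<in> T" for t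
  proof -
    let ?m = "return_exp G K \<gamma> t"
    let ?r = "coset_rep (K #> t)"
    have mem: "?r \<otimes> inv t \<in> K"
      using coset_eq_diff[OF K _ tc[OF t]] coset_rep[OF tc[OF t]] by simp
    \<comment> \<open>After \<open>?m\<close> steps the cycle is closed, so both ends of the telescoping product are \<open>?r\<close>.\<close>
    have "inj_on (orbit_coset \<gamma> t) {..<?m}"
      using orbit_coset_inj[OF \<gamma> tc[OF t]] by (intro inj_onI) auto
    then have "(\<Otimes>\<^bsub>A\<^esub>C\<in>orbit_coset \<gamma> t ` {..<?m}. \<phi> (cocycle \<gamma> C))
        = (\<Otimes>\<^bsub>A\<^esub>i\<in>{..<?m}. \<phi> (cocycle \<gamma> (orbit_coset \<gamma> t i)))"
      using closed orbit_coset_mem[OF \<gamma> tc[OF t]] by (intro A.finprod_reindex) auto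
    also have "\<dots> = \<phi> (coset_rep (orbit_coset \<gamma> t 0) \<otimes> \<gamma> [^] ?m \<otimes> inv (coset_rep (orbit_coset \<gamma> t ?m)))"
      using prod_cocycle_orbit[OF A \<phi> \<gamma> tc[OF t]] by blast
    also have "orbit_coset \<gamma> t ?m = orbit_coset \<gamma> t 0"
      using orbit_coset_eq_iff[OF \<gamma> tc[OF t], of 0 ?m] return_exp_props[OF \<gamma> tc[OF t]]
      by (simp add: stab_gen_def)
    also have "orbit_coset \<gamma> t 0 = K #> t" using tc[OF t] by (simp add: orbit_coset_def)
    also have "?r \<otimes> \<gamma> [^] ?m \<otimes> inv ?r = conj_by G (?r \<otimes> inv t) (stab_gen G K \<gamma> t)"
      using coset_rep(1)[OF tc[OF t]] tc[OF t] \<gamma>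
      by (simp add: stab_gen_def conj_by_mult_left) (simp add: conj_by_def)
    also have "\<dots> = conj_by GK (?r \<otimes> inv t) (stab_gen G K \<gamma> t)"
      using mem by simp
    also have "\<phi> \<dots> = \<phi> (stab_gen G K \<gamma> t)"
      using \<phi>.hom_conj_by[OF A, of "?r \<otimes> inv t" "stab_gen G K \<gamma> t"]
        mem return_exp_props[OF \<gamma> tc[OF t]] by simp
    finally show ?thesis .
  qed
  have "finite T" using tc finite_subset[OF _ fin] by blast
  have "transfer A \<phi> \<gamma> = (\<Otimes>\<^bsub>A\<^esub>t\<in>T. \<Otimes>\<^bsub>A\<^esub>C\<in>orbit_coset \<gamma> t ` {..<return_exp G K \<gamma> t}. \<phi> (cocycle \<gamma> C))"
    unfolding transfer_def rcosets_eq_UN_orbits[OF \<gamma> T]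
    using \<open>finite T\<close> orbits_disjoint[OF \<gamma> T] closed orbit_coset_mem[OF \<gamma> tc]
    by (intro A.finprod_UN_disjoint) (auto simp: pairwise_def disjnt_iff)
  also have "\<dots> = (\<Otimes>\<^bsub>A\<^esub>t\<in>T. \<phi> (stab_gen G K \<gamma> t))"
    using orbit return_exp_props[OF \<gamma> tc] \<phi>.hom_closed by (intro A.finprod_cong') auto
  finally show ?thesis .
qed

end

section \<open>Restriction of orbit data is well defined\<close>

lemma (in group) derived_coset_hom:
  "(#>) (derived G (carrier G)) \<in> hom G (G Mod derived G (carrier G))"
  by (rule normal.r_coset_hom_Mod[OF derived_self_is_normal])

lemma (in group) derived_coset_eq_one_iff:
  "x \<in> carrier G \<Longrightarrow>
   derived G (carrier G) #> x = \<one>\<^bsub>G Mod derived G (carrier G)\<^esub> \<longleftrightarrow> x \<in> derived G (carrier G)"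
  using coset_join1[of "derived G (carrier G)" x] coset_join2[of x "derived G (carrier G)"]
    subgroup_derived by (auto simp: FactGroup_def)

lemma (in group) hom_comm_group_derived:
  assumes A: "comm_group A" and V: "V \<in> hom G A" and x: "x \<in> derived G (carrier G)"
  shows "V x = \<one>\<^bsub>A\<^esub>"
proof -
  interpret A: comm_group A by (rule A)
  interpret V: group_hom G A V using V by unfold_locales
  show ?thesis using V.hom_derived_mem[OF x] A.derived_eq_singleton by simp
qed

lemma (in group_hom) hom_foldr_distinct:
  assumes "comm_group H" "distinct ts" "\<And>t. t \<in> set ts \<Longrightarrow> f t \<in> carrier G"
  shows "h (foldr (\<otimes>) (map f ts) \<one>) = (\<Otimes>\<^bsub>H\<^esub>t\<in>set ts. h (f t))"
proof -
  interpret H: comm_group H by fact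
  show ?thesis
    using assms(2,3)
  proof (induction ts)
    case (Cons t ts)
    have "foldr (\<otimes>) (map f ts) \<one> \<in> carrier G"
      using Cons.prems by (intro G.foldr_mult_closed) auto
    then show ?case using Cons by (simp add: Pi_def)
  qed simp
qed

context finite_restriction
begin

lemma set_concat_res_tuples:
  "set \<gamma>s \<subseteq> carrier G \<Longrightarrow> set (concat (map (res_tuple G K) \<gamma>s)) \<subseteq> K"
  by (induction \<gamma>s) (simp_all add: set_res_tuple)

lemma foldr_res_tuples:
  assumes A: "comm_group A" and \<phi>: "\<phi> \<in> hom GK A" and \<gamma>s: "set \<gamma>s \<subseteq> carrier G"
  shows "\<phi> (foldr (\<otimes>) (concat (map (res_tuple G K) \<gamma>s)) \<one>) = transfer A \<phi> (foldr (\<otimes>) \<gamma>s \<one>)"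
proof -
  interpret A: comm_group A by (rule A)
  interpret \<phi>: group_hom GK A \<phi> using \<phi> by unfold_locales
  interpret V: group_hom G A "transfer A \<phi>"
    using transfer_hom[OF A \<phi>] by unfold_locales
  show ?thesis
    using \<gamma>s
  proof (induction \<gamma>s)
    case Nil
    then show ?case using \<phi>.hom_one by simp
  next
    case (Cons \<gamma> \<gamma>s)
    then have \<gamma>: "\<gamma> \<in> carrier G" and \<gamma>s: "set \<gamma>s \<subseteq> carrier G" by auto
    note reps = orbit_reps[OF \<gamma>]
    have head: "\<phi> (foldr (\<otimes>) (res_tuple G K \<gamma>) \<one>) = transfer A \<phi> \<gamma>"
      unfolding transfer_eval[OF A \<phi> \<gamma> reps(2)] res_tuple_def
      using \<phi>.hom_foldr_distinct[OF A reps(1), of "stab_gen G K \<gamma>"] return_exp_props[OF \<gamma>]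
        dcoset_transversalD(1)[OF reps(2)] by simp
    have tail: "set (concat (map (res_tuple G K) \<gamma>s)) \<subseteq> K"
      using \<gamma>s by (rule set_concat_res_tuples)
    have "foldr (\<otimes>) (concat (map (res_tuple G K) (\<gamma> # \<gamma>s))) \<one>
        = foldr (\<otimes>) (res_tuple G K \<gamma>) \<one> \<otimes> foldr (\<otimes>) (concat (map (res_tuple G K) \<gamma>s)) \<one>"
      using GK.foldr_mult_append[of "res_tuple G K \<gamma>" "concat (map (res_tuple G K) \<gamma>s)"]
        set_res_tuple[OF \<gamma>] tail by simp
    moreover have "\<phi> (foldr (\<otimes>) (res_tuple G K \<gamma>) \<one> \<otimes> foldr (\<otimes>) (concat (map (res_tuple G K) \<gamma>s)) \<one>)
        = transfer A \<phi> \<gamma> \<otimes>\<^bsub>A\<^esub> transfer A \<phi> (foldr (\<otimes>) \<gamma>s \<one>)"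
      using \<phi>.hom_mult[of "foldr (\<otimes>) (res_tuple G K \<gamma>) \<one>" "foldr (\<otimes>) (concat (map (res_tuple G K) \<gamma>s)) \<one>"]
        GK.foldr_mult_closed[of "res_tuple G K \<gamma>"] set_res_tuple[OF \<gamma>]
        tail
        GK.foldr_mult_closed[of "concat (map (res_tuple G K) \<gamma>s)"] head Cons.IH[OF \<gamma>s]
      by simp
    ultimately show ?case using \<gamma> foldr_mult_closed[OF \<gamma>s] by simp
  qed
qed

text \<open>
  The product of the restricted tuple, read in the abelianization of \<open>K\<close>, is the transfer of an
  element of the commutator subgroup of \<open>G\<close>.
\<close>
lemma res_tuple_admissible:
  assumes "\<gamma>s \<in> admissible G"
  shows "concat (map (res_tuple G K) \<gamma>s) \<in> admissible GK"
proof -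
  have \<gamma>s: "set \<gamma>s \<subseteq> carrier G" using assms by (simp add: admissible_def)
  have sub: "set (concat (map (res_tuple G K) \<gamma>s)) \<subseteq> carrier GK"
    using set_concat_res_tuples[OF \<gamma>s] by simp
  let ?A = "GK Mod derived GK (carrier GK)"
  note A = GK.derived_quot_is_comm_group and \<phi> = GK.derived_coset_hom
  let ?p = "foldr (\<otimes>) (concat (map (res_tuple G K) \<gamma>s)) \<one>"
  have p: "?p \<in> carrier GK" using GK.foldr_mult_closed[OF sub] by simp
  have "derived GK (carrier GK) #>\<^bsub>GK\<^esub> ?p = \<one>\<^bsub>?A\<^esub>"
    using foldr_res_tuples[OF A \<phi> \<gamma>s] hom_comm_group_derived[OF A transfer_hom[OF A \<phi>]] assms
    by (simp add: admissible_def)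
  then have "?p \<in> derived GK (carrier GK)" using GK.derived_coset_eq_one_iff[OF p] by blast
  then show ?thesis using sub by (simp add: admissible_def)
qed

lemma tuple_rule_res: "tuple_rule G GK (res_tuple G K)"
  by unfold_locales
    (auto simp: res_tuple_admissible class_tuple_res_tuple_conj class_tuple_res_tuple_one
      class_tuple_res_tuple_inv)

lemma BB_res_eq_induced_map: "BB_res G K = induced_map G GK (res_tuple G K)"
proof -
  have "reduce_classes GK (\<Sum>\<gamma>\<leftarrow>\<gamma>s. res_classes G K \<gamma>) = class_tuple GK (concat (map (res_tuple G K) \<gamma>s))"
    if "\<gamma>s \<in> admissible G" for \<gamma>s
  proof -
    have "set \<gamma>s \<subseteq> carrier G" using that by (simp add: admissible_def)
    then show ?thesis
      by (induction \<gamma>s) (auto simp: reduce_classes_def class_tuple_append class_tuple_res_tuple)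
  qed
  then show ?thesis by (simp add: BB_res_def induced_map_def fun_eq_iff cong: conj_cong bex_cong)
qed

end

section \<open>The double coset formula\<close>
lemma (in group) subgroup_conj:
  assumes "s \<in> carrier G" "subgroup H G"
  shows "subgroup (conj_by G s ` H) G"
proof -
  interpret c: group_hom G G "conj_by G s" using assms by unfold_locales (simp add: conj_by_hom)
  show ?thesis by (rule c.subgroup_img_is_subgroup[OF assms(2)])
qed

lemma (in group) conj_by_subgroup:
  "subgroup L G \<Longrightarrow> u \<in> L \<Longrightarrow> conj_by (G\<lparr>carrier := L\<rparr>) u x = conj_by G u x"
  by (simp add: conj_by_def)

lemma (in group) finite_restriction_conj_Int:
  assumes fin: "finite (carrier G)" and H: "subgroup H G" and K: "subgroup K G"
    and s: "s \<in> carrier G"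
  shows "finite_restriction (G\<lparr>carrier := conj_by G s ` H\<rparr>) (conj_by G s ` H \<inter> K)"
proof -
  let ?C = "conj_by G s ` H"
  note C = subgroup_conj[OF s H]
  interpret C: group "G\<lparr>carrier := ?C\<rparr>" by (rule subgroup.subgroup_is_group[OF C is_group])
  show ?thesis
  proof (intro finite_restriction.intro finite_restriction_axioms.intro C.is_group)
    show "finite (carrier (G\<lparr>carrier := ?C\<rparr>))"
      using finite_subset[OF subgroup.subset[OF C] fin] by simp
    show "subgroup (?C \<inter> K) (G\<lparr>carrier := ?C\<rparr>)"
      using subgroups_Inter_pair[OF C K] C by (intro subgroup_incl) auto
  qed
qed

text \<open>
  Both sides conjugate powers of \<open>\<gamma>\<close> by \<open>u s\<close>. On the left the exponent is required to bring the result
  into \<open>s H s\<^sup>-\<^sup>1 \<inter> K\<close>, on the right only into \<open>K\<close>; since \<open>\<gamma> \<in> H\<close>, the result lies in \<open>s H s\<^sup>-\<^sup>1\<close> in any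
  case.
\<close>
lemma (in group) stab_gen_mackey:
  assumes H: "subgroup H G" and K: "subgroup K G" and s: "s \<in> carrier G"
    and \<gamma>: "\<gamma> \<in> H" and u: "u \<in> conj_by G s ` H"
  shows "stab_gen (G\<lparr>carrier := conj_by G s ` H\<rparr>) (conj_by G s ` H \<inter> K) (conj_by G s \<gamma>) u
    = stab_gen G K \<gamma> (u \<otimes> s)"
proof -
  let ?C = "conj_by G s ` H"
  note C = subgroup_conj[OF s H]
  interpret C: group "G\<lparr>carrier := ?C\<rparr>" by (rule subgroup.subgroup_is_group[OF C is_group])
  have \<gamma>c: "\<gamma> \<in> carrier G" by (rule subgroup.mem_carrier[OF H \<gamma>])
  have uc: "u \<in> carrier G" by (rule subgroup.mem_carrier[OF C u])
  have eq: "conj_by (G\<lparr>carrier := ?C\<rparr>) u (conj_by G s \<gamma> [^]\<^bsub>G\<lparr>carrier := ?C\<rparr>\<^esub> m)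
      = conj_by G (u \<otimes> s) (\<gamma> [^] m)" for m :: nat
    using u uc s \<gamma>c by (simp add: conj_by_subgroup[OF C u] conj_by_mult_left conj_by_pow
        flip: nat_pow_consistent)
  have "conj_by (G\<lparr>carrier := ?C\<rparr>) u (conj_by G s \<gamma> [^]\<^bsub>G\<lparr>carrier := ?C\<rparr>\<^esub> m) \<in> ?C" for m :: nat
  proof -
    have "conj_by G s \<gamma> \<in> ?C" using \<gamma> by blast
    then show ?thesis
      using C.conj_by_closed[of u] C.nat_pow_closed[of "conj_by G s \<gamma>" m] u by simp
  qed
  then have "conj_by G (u \<otimes> s) (\<gamma> [^] m) \<in> ?C" for m :: nat
    by (simp only: eq)
  then have "return_exp (G\<lparr>carrier := ?C\<rparr>) (?C \<inter> K) (conj_by G s \<gamma>) u = return_exp G K \<gamma> (u \<otimes> s)"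
    by (simp add: return_exp_def eq)
  then show ?thesis by (simp add: stab_gen_def eq)
qed

text \<open>
  The double coset formula for a single entry. The classes on the right are taken in \<open>K\<close>, which
  accounts for the map induced by the inclusion of \<open>s H s\<^sup>-\<^sup>1 \<inter> K\<close> in \<open>K\<close>.
\<close>
lemma (in group) res_tuple_mackey:
  assumes fin: "finite (carrier G)" and H: "subgroup H G" and K: "subgroup K G"
    and S: "dcoset_transversal G K H S" and \<gamma>: "\<gamma> \<in> H"
  defines "C \<equiv> \<lambda>s. conj_by G s ` H"
  shows "class_tuple (G\<lparr>carrier := K\<rparr>) (res_tuple G K \<gamma>) =
    (\<Sum>s\<in>S. class_tuple (G\<lparr>carrier := K\<rparr>)
      (res_tuple (G\<lparr>carrier := C s\<rparr>) (C s \<inter> K) (conj_by G s \<gamma>)))"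
proof -
  let ?GK = "G\<lparr>carrier := K\<rparr>"
  let ?reps = "\<lambda>s. orbit_reps (G\<lparr>carrier := C s\<rparr>) (C s \<inter> K) (conj_by G s \<gamma>)"
  interpret GK: finite_restriction G K
    by (intro finite_restriction.intro finite_restriction_axioms.intro is_group fin K)
  have \<gamma>c: "\<gamma> \<in> carrier G" by (rule subgroup.mem_carrier[OF H \<gamma>])
  have Sc: "s \<in> carrier G" if "s \<in> S" for s using dcoset_transversalD(1)[OF S that] .
  have finS: "finite S" using Sc finite_subset[OF _ fin] by blast
  have restr: "finite_restriction (G\<lparr>carrier := C s\<rparr>) (C s \<inter> K)" if "s \<in> S" for s
    unfolding C_def by (rule finite_restriction_conj_Int[OF fin H K Sc[OF that]])
  have reps: "distinct (?reps s)"
    "dcoset_transversal (G\<lparr>carrier := C s\<rparr>) (C s \<inter> K) (conj_by G s ` generate G {\<gamma>}) (set (?reps s))"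
    if "s \<in> S" for s
  proof -
    have C: "subgroup (C s) G" unfolding C_def by (rule subgroup_conj[OF Sc[OF that] H])
    have mem: "conj_by G s \<gamma> \<in> C s" using \<gamma> by (simp add: C_def)
    have "generate (G\<lparr>carrier := C s\<rparr>) {conj_by G s \<gamma>} = conj_by G s ` generate G {\<gamma>}"
      using generate_consistent[OF _ C, of "{conj_by G s \<gamma>}"] mem conj_by_generate[OF Sc[OF that] \<gamma>c]
      by simp
    then show "distinct (?reps s)"
      "dcoset_transversal (G\<lparr>carrier := C s\<rparr>) (C s \<inter> K) (conj_by G s ` generate G {\<gamma>}) (set (?reps s))"
      using finite_restriction.orbit_reps[OF restr[OF that], of "conj_by G s \<gamma>"] mem by simp_all
  qed
  have Z: "generate G {\<gamma>} \<subseteq> H" using generate_subgroup_incl[OF _ H, of "{\<gamma>}"] \<gamma> by simp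
  have C_app: "conj_by G s ` H = C s" for s by (simp add: C_def)
  note mackey = dcoset_transversal_mackey[OF H K GK.subgroup_generate[OF \<gamma>c] Z S, unfolded C_app,
      of "\<lambda>s. set (?reps s)", OF reps(2)]
  have "class_tuple ?GK (res_tuple G K \<gamma>)
      = (\<Sum>t\<in>(\<lambda>(s, u). u \<otimes> s) ` (SIGMA s:S. set (?reps s)). class_tuple ?GK [stab_gen G K \<gamma> t])"
    by (rule GK.class_tuple_res_tuple_transversal[OF \<gamma>c mackey(2)])
  also have "\<dots> = (\<Sum>(s, u)\<in>(SIGMA s:S. set (?reps s)). class_tuple ?GK [stab_gen G K \<gamma> (u \<otimes> s)])"
    using mackey(1) by (simp add: sum.reindex case_prod_unfold)
  also have "\<dots> = (\<Sum>s\<in>S. \<Sum>u\<in>set (?reps s). class_tuple ?GK [stab_gen G K \<gamma> (u \<otimes> s)])"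
    using finS by (simp add: sum.Sigma)
  also have "\<dots> = (\<Sum>s\<in>S. \<Sum>u\<in>set (?reps s).
      class_tuple ?GK [stab_gen (G\<lparr>carrier := C s\<rparr>) (C s \<inter> K) (conj_by G s \<gamma>) u])"
  proof (intro sum.cong refl)
    fix s u assume s: "s \<in> S" and u: "u \<in> set (?reps s)"
    then have "u \<in> C s" using dcoset_transversalD(1)[OF reps(2)[OF s] u] by simp
    then show "class_tuple ?GK [stab_gen G K \<gamma> (u \<otimes> s)]
        = class_tuple ?GK [stab_gen (G\<lparr>carrier := C s\<rparr>) (C s \<inter> K) (conj_by G s \<gamma>) u]"
      using stab_gen_mackey[OF H K Sc[OF s] \<gamma>] by (simp add: C_def)
  qed
  also have "\<dots> = (\<Sum>s\<in>S. class_tuple ?GK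
      (res_tuple (G\<lparr>carrier := C s\<rparr>) (C s \<inter> K) (conj_by G s \<gamma>)))"
    using reps(1) by (intro sum.cong refl) (simp add: res_tuple_def class_tuple_map_distinct)
  finally show ?thesis .
qed

theorem proposition5:
  fixes G :: "('a, 'm) monoid_scheme" and H K S :: "'a set"
  assumes "group G" and "finite (carrier G)"
    and "subgroup H G" and "subgroup K G"
    and "S \<subseteq> carrier G"
    and "disjoint_family_on (\<lambda>s. dcoset G K s H) S"
    and "(\<Union>s\<in>S. dcoset G K s H) = carrier G"
  shows "let GH = G\<lparr>carrier := H\<rparr>; GK = G\<lparr>carrier := K\<rparr>;
      cH = (\<lambda>s. conj_by G s ` H);
      Hs = (\<lambda>s. cH s \<inter> K);
      L = BB_res G K \<circ> BB_map GH G id;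
      R = (\<lambda>s. BB_map (G\<lparr>carrier := Hs s\<rparr>) GK id
                \<circ> BB_res (G\<lparr>carrier := cH s\<rparr>) (Hs s)
                \<circ> BB_map GH (G\<lparr>carrier := cH s\<rparr>) (conj_by G s))
    in L \<in> hom (BB GH) (BB GK) \<and>
       (\<forall>s\<in>S. R s \<in> hom (BB GH) (BB GK)) \<and>
       (\<forall>\<xi>\<in>carrier (BB GH). L \<xi> = (\<Otimes>\<^bsub>BB GK\<^esub>s\<in>S. R s \<xi>))"
proof -
  interpret group G by fact
  interpret GK: finite_restriction G K
    by (intro finite_restriction.intro finite_restriction_axioms.intro assms)
  define GH where "GH = G\<lparr>carrier := H\<rparr>"
  define GK where "GK = G\<lparr>carrier := K\<rparr>"
  define C where "C s = conj_by G s ` H" for s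
  define GC where "GC s = G\<lparr>carrier := C s\<rparr>" for s
  define GHs where "GHs s = G\<lparr>carrier := C s \<inter> K\<rparr>" for s
  define L where "L = BB_res G K \<circ> BB_map GH G id"
  define R where "R s = BB_map (GHs s) GK id \<circ> BB_res (GC s) (C s \<inter> K) \<circ> BB_map GH (GC s) (conj_by G s)" for s
  have GHs_alt: "GHs s = (GC s)\<lparr>carrier := C s \<inter> K\<rparr>" for s by (simp add: GHs_def GC_def)
  have S: "dcoset_transversal G K H S"
    unfolding dcoset_transversal_def
  proof (intro conjI ballI)
    fix g assume "g \<in> carrier G"
    then obtain s where "s \<in> S" "g \<in> dcoset G K s H" using assms(7) by blast
    then show "\<exists>!s. s \<in> S \<and> g \<in> dcoset G K s H"
      using assms(6) by (intro ex1I[of _ s]) (auto simp: disjoint_family_on_def)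
  qed (rule assms(5))
  have finS: "finite S" using assms(2,5) finite_subset by blast
  have Hc: "H \<subseteq> carrier G" using assms(3) by (rule subgroup.subset)
  have gH: "group GH" unfolding GH_def by (rule subgroup.subgroup_is_group[OF assms(3) is_group])
  have gK: "group GK" unfolding GK_def by (rule subgroup.subgroup_is_group[OF assms(4) is_group])
  have C: "subgroup (C s) G" if "s \<in> S" for s
    using that assms(3,5) by (auto simp: C_def intro!: subgroup_conj)
  have gC: "group (GC s)" if "s \<in> S" for s
    unfolding GC_def by (rule subgroup.subgroup_is_group[OF C[OF that] is_group])
  have Hs: "subgroup (C s \<inter> K) G" if "s \<in> S" for s
    by (rule subgroups_Inter_pair[OF C[OF that] assms(4)])
  have gHs: "group (GHs s)" if "s \<in> S" for s
    unfolding GHs_def by (rule subgroup.subgroup_is_group[OF Hs[OF that] is_group])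
  have restr: "finite_restriction (GC s) (C s \<inter> K)" if "s \<in> S" for s
    unfolding GC_def C_def
    using that assms(5) by (intro finite_restriction_conj_Int assms(2-4)) auto
  interpret iG: tuple_rule GH G "\<lambda>x. [id x]"
    using gH is_group Hc
    by (intro group_hom.tuple_rule_hom) (auto simp: group_hom_def group_hom_axioms_def hom_def GH_def)
  interpret resG: tuple_rule G GK "res_tuple G K"
    unfolding GK_def by (rule GK.tuple_rule_res)
  have conj: "tuple_rule GH (GC s) (\<lambda>x. [conj_by G s x])" if "s \<in> S" for s
    using gH gC[OF that] Hc assms(5) that
    by (intro group_hom.tuple_rule_hom)
      (auto simp: group_hom_def group_hom_axioms_def hom_def GH_def GC_def C_def conj_by_mult_right subset_iff)
  have res: "tuple_rule (GC s) (GHs s) (res_tuple (GC s) (C s \<inter> K))" if "s \<in> S" for s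
    unfolding GHs_alt by (rule finite_restriction.tuple_rule_res[OF restr[OF that]])
  have incl: "tuple_rule (GHs s) GK (\<lambda>x. [id x])" if "s \<in> S" for s
    using gHs[OF that] gK
    by (intro group_hom.tuple_rule_hom) (auto simp: group_hom_def group_hom_axioms_def hom_def GHs_def GK_def)
  have L_eq: "L = induced_map G GK (res_tuple G K) \<circ> induced_map GH G (\<lambda>x. [id x])"
    by (simp add: L_def BB_map_eq_induced_map GK.BB_res_eq_induced_map GK_def)
  have R_eq: "R s = induced_map (GHs s) GK (\<lambda>x. [id x]) \<circ> induced_map (GC s) (GHs s) (res_tuple (GC s) (C s \<inter> K))
      \<circ> induced_map GH (GC s) (\<lambda>x. [conj_by G s x])" if "s \<in> S" for s
    using finite_restriction.BB_res_eq_induced_map[OF restr[OF that]]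
    by (simp add: R_def BB_map_eq_induced_map GHs_alt)
  have L_hom: "L \<in> hom (BB GH) (BB GK)"
    unfolding L_eq by (rule Group.hom_compose[OF iG.induced_map_hom resG.induced_map_hom])
  have R_hom: "R s \<in> hom (BB GH) (BB GK)" if "s \<in> S" for s
    unfolding R_eq[OF that]
    by (intro Group.hom_compose[OF tuple_rule.induced_map_hom[OF conj[OF that]]]
        Group.hom_compose[OF tuple_rule.induced_map_hom[OF res[OF that]]]
        tuple_rule.induced_map_hom[OF incl[OF that]])
  have "L \<xi> = (\<Otimes>\<^bsub>BB GK\<^esub>s\<in>S. R s \<xi>)" if \<xi>: "\<xi> \<in> carrier (BB GH)" for \<xi>
  proof -
    obtain \<gamma>s where \<gamma>s: "\<gamma>s \<in> admissible GH" "\<xi> = BB_proj GH (class_tuple GH \<gamma>s)"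
      using group.BB_cases[OF gH \<xi>] .
    let ?r = "\<lambda>s \<gamma>s. concat (map (\<lambda>\<gamma>. res_tuple (GC s) (C s \<inter> K) (conj_by G s \<gamma>)) \<gamma>s)"
    have L_\<xi>: "L \<xi> = BB_proj GK (class_tuple GK (concat (map (res_tuple G K) \<gamma>s)))"
      unfolding L_eq o_apply \<gamma>s(2) iG.induced_map_proj[OF \<gamma>s(1)]
        resG.induced_map_proj[OF iG.admissible[OF \<gamma>s(1)]] by simp
    have R_\<xi>: "?r s \<gamma>s \<in> admissible GK \<and> R s \<xi> = BB_proj GK (class_tuple GK (?r s \<gamma>s))" if s: "s \<in> S" for s
    proof -
      note a1 = tuple_rule.admissible[OF conj[OF s] \<gamma>s(1)]
      note a2 = tuple_rule.admissible[OF res[OF s] a1]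
      note a3 = tuple_rule.admissible[OF incl[OF s] a2]
      show ?thesis
        using a3 unfolding R_eq[OF s] \<gamma>s(2) o_apply
          tuple_rule.induced_map_proj[OF conj[OF s] \<gamma>s(1)]
          tuple_rule.induced_map_proj[OF res[OF s] a1]
          tuple_rule.induced_map_proj[OF incl[OF s] a2]
        by (simp add: comp_def)
    qed
    have mem: "class_tuple GK (?r s \<gamma>s) \<in> carrier (Lam GK)" if "s \<in> S" for s
      using group.class_tuple_in_Lam[OF gK] R_\<xi>[OF that] by blast
    have "set \<gamma>s \<subseteq> H" using \<gamma>s(1) by (simp add: admissible_def GH_def)
    then have "class_tuple GK (concat (map (res_tuple G K) \<gamma>s)) = (\<Sum>s\<in>S. class_tuple GK (?r s \<gamma>s))"
    proof (induction \<gamma>s)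
      case (Cons \<gamma> \<gamma>s)
      then show ?case
        using res_tuple_mackey[OF assms(2-4) S, of \<gamma>]
        by (simp add: class_tuple_append sum.distrib GK_def GC_def C_def)
    qed simp
    then have "L \<xi> = (\<Otimes>\<^bsub>BB GK\<^esub>s\<in>S. BB_proj GK (class_tuple GK (?r s \<gamma>s)))"
      using group.finprod_BB[OF gK finS mem] L_\<xi> by simp
    also have "\<dots> = (\<Otimes>\<^bsub>BB GK\<^esub>s\<in>S. R s \<xi>)"
    proof -
      interpret BBK: comm_group "BB GK" by (rule group.comm_group_BB[OF gK])
      show ?thesis
        using R_\<xi> hom_in_carrier[OF R_hom \<xi>] by (intro BBK.finprod_cong') auto
    qed
    finally show ?thesis .
  qed
  then show ?thesis
    using L_hom R_hom
    unfolding Let_def L_def R_def GH_def GK_def GC_def GHs_def C_def by blast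
qed

end
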